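(* Let $T>0$ and let $\mu$ be a finite measure on $([0,T],\mathcal{B}or([0,T]))$. Let $X=(X_t)_{t\in[0,T]}$ be a real-valued càdlàg process with independent increments such that, for every $u\in\mathbb{R}$, $t\mapsto\mathbb{E}\,e^{uX_t}$ is bounded and bounded away from $0$ over $[0,T]$, and set $\Psi(u,t)=\log\mathbb{E}\,e^{uX_t}$. Then the process $$\Big(\int_0^Te^{\sigma X_t-\Psi(\sigma,t)}\,\mu(dt)\Big)_{\sigma\in\mathbb{R}_+}$$ is a peacock.
   Context: A process with independent increments is a process such that $X_t-X_s$ is independent of $\sigma(X_u,\,u\le s)$ for all $s\le t$. An integrable real-valued process $(Y_\lambda)_{\lambda\ge0}$ is a peacock if, for every convex function $\varphi:\mathbb{R}\to\mathbb{R}$, the $(-\infty,+\infty]$-valued function $\lambda\mapsto\mathbb{E}\,\varphi(Y_\lambda)$ is non-decreasing. The integral $\int_0^T$ is over the closed interval $[0,T]$. *)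

theory Defs
  imports "HOL-Probability.Probability"
begin

definition cadlag_on :: "real \<Rightarrow> real \<Rightarrow> (real \<Rightarrow> real) \<Rightarrow> bool" where
  "cadlag_on a b f \<longleftrightarrow>
     (\<forall>t\<in>{a..<b}. continuous (at_right t) f) \<and>
     (\<forall>t\<in>{a<..b}. \<exists>l. (f \<longlongrightarrow> l) (at_left t))"

definition generated_sigma :: "'a measure \<Rightarrow> real set \<Rightarrow> (real \<Rightarrow> 'a \<Rightarrow> real) \<Rightarrow> 'a set set" where
  "generated_sigma M I X =
     sigma_sets (space M) (\<Union>u\<in>I. {X u -` A \<inter> space M | A. A \<in> sets borel})"

text \<open>Processes indexed by the interval from 0 to T are functions on all reals;
  their values at times outside that interval are never used.\<close>

definition independent_increments :: "'a measure \<Rightarrow> real \<Rightarrow> (real \<Rightarrow> 'a \<Rightarrow> real) \<Rightarrow> bool" where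
  "independent_increments M T X \<longleftrightarrow>
     (\<forall>s t. 0 \<le> s \<and> s \<le> t \<and> t \<le> T \<longrightarrow>
        prob_space.indep_set M
          (sets (vimage_algebra (space M) (\<lambda>\<omega>. X t \<omega> - X s \<omega>) borel))
          (generated_sigma M {0..s} X))"

definition log_mgf :: "'a measure \<Rightarrow> (real \<Rightarrow> 'a \<Rightarrow> real) \<Rightarrow> real \<Rightarrow> real \<Rightarrow> real" where
  "log_mgf M X u t = ln (\<integral>\<omega>. exp (u * X t \<omega>) \<partial>M)"

text \<open>The expectation of a random variable as the difference of the integrals of its positive
  and negative parts (the coercion to \<^typ>\<open>ennreal\<close> truncates negative numbers to 0). If
  \<open>Y\<close> is integrable and \<open>\<phi>\<close> is convex, then \<open>\<phi>\<close> has an affine minorant, so the negative part of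
  \<open>\<phi> (Y \<omega>)\<close> has a finite integral and the difference is the usual value, which lies above
  minus infinity.\<close>

definition ext_expectation :: "'a measure \<Rightarrow> ('a \<Rightarrow> real) \<Rightarrow> ereal" where
  "ext_expectation M f =
     enn2ereal (\<integral>\<^sup>+\<omega>. ennreal (f \<omega>) \<partial>M) - enn2ereal (\<integral>\<^sup>+\<omega>. ennreal (- f \<omega>) \<partial>M)"

definition peacock :: "'a measure \<Rightarrow> (real \<Rightarrow> 'a \<Rightarrow> real) \<Rightarrow> bool" where
  "peacock M Y \<longleftrightarrow>
     (\<forall>l\<ge>0. integrable M (Y l)) \<and>
     (\<forall>\<phi> :: real \<Rightarrow> real. convex_on UNIV \<phi> \<longrightarrow>
        mono_on {0..} (\<lambda>l. ext_expectation M (\<lambda>\<omega>. \<phi> (Y l \<omega>))))"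

end

theory Submission
  imports Defs
begin

text \<open>Write \<open>Z\<^sub>\<sigma>(t) = exp (\<sigma> X\<^sub>t - \<Psi>(\<sigma>, t))\<close> and \<open>Y\<^sub>\<sigma> = \<integral> Z\<^sub>\<sigma>(t) d\<mu>\<close>. If \<open>g\<close> is the right derivative of \<open>\<phi>\<close>
  then \<open>\<phi>(Y\<^sub>\<tau>) \<ge> \<phi>(Y\<^sub>\<sigma>) + g(Y\<^sub>\<sigma>) (Y\<^sub>\<tau> - Y\<^sub>\<sigma>)\<close>, so it suffices that \<open>g(Y\<^sub>\<sigma>) (Z\<^sub>\<tau>(t) - Z\<^sub>\<sigma>(t))\<close> has nonnegative
  mean for every bounded increasing \<open>g\<close>, every \<open>t\<close> and \<open>\<sigma> \<le> \<tau>\<close>. By right continuity of the paths,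
  \<open>Y\<^sub>\<sigma>\<close> may be replaced by an increasing function of the increments of \<open>X\<close> along a finite grid
  through \<open>t\<close>. The factor \<open>Z\<^sub>\<sigma>(t)\<close> is a product of exponential weights of mean 1, one for each
  increment before \<open>t\<close>. Pass from \<open>Z\<^sub>\<sigma>(t)\<close> to \<open>Z\<^sub>\<tau>(t)\<close> by exchanging these weights one at a time:
  the difference of the two weights of an increment has mean 0 and changes sign once, from negative
  to positive, hence its integral against an increasing function of that increment is nonnegative.\<close>

subsection \<open>Exchanging the weights of independent variables\<close>

text \<open>Freezing the first argument of \<open>F\<close> at the crossing point \<open>c\<close> of \<open>a\<close> only lowers the
  integrand, and the frozen integral factorises.\<close>

lemma (in prob_space) indep_single_crossing_nonneg:
  fixes F :: "'b \<Rightarrow> 'b \<Rightarrow> real" and W a :: "'b \<Rightarrow> real"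
  assumes ind: "indep_var L U N V"
    and F [measurable]: "(\<lambda>(u, v). F u v) \<in> borel_measurable (L \<Otimes>\<^sub>M N)"
    and bdd: "\<And>u v. \<bar>F u v\<bar> \<le> C"
    and W [measurable]: "W \<in> borel_measurable N"
    and W_int: "integrable M (\<lambda>\<omega>. W (V \<omega>))" and W_nonneg: "\<And>v. 0 \<le> W v"
    and a [measurable]: "a \<in> borel_measurable L"
    and a_int: "integrable M (\<lambda>\<omega>. a (U \<omega>))" and a_mean: "expectation (\<lambda>\<omega>. a (U \<omega>)) = 0"
    and c: "c \<in> space L"
    and cross: "\<And>u v. v \<in> space N \<Longrightarrow> F c v * a u \<le> F u v * a u"
  shows "0 \<le> expectation (\<lambda>\<omega>. F (U \<omega>) (V \<omega>) * (a (U \<omega>) * W (V \<omega>)))"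
proof -
  have [measurable]: "U \<in> measurable M L" "V \<in> measurable M N"
    using indep_var_rv1[OF ind] indep_var_rv2[OF ind] by auto
  have V: "V \<omega> \<in> space N" if "\<omega> \<in> space M" for \<omega>
    using measurable_space[OF \<open>V \<in> measurable M N\<close> that] .
  have FV [measurable]: "(\<lambda>\<omega>. F (U \<omega>) (V \<omega>)) \<in> borel_measurable M"
    "(\<lambda>v. F c v) \<in> borel_measurable N"
    using F c by measurable
  have ind2: "indep_var borel (a \<circ> U) borel ((\<lambda>v. F c v * W v) \<circ> V)"
    by (rule indep_var_compose[OF ind]) auto
  have ind3: "indep_var borel (a \<circ> U) borel (W \<circ> V)"
    by (rule indep_var_compose[OF ind]) auto
  have aW_int: "integrable M (\<lambda>\<omega>. a (U \<omega>) * W (V \<omega>))"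
    using indep_var_integrable[OF ind3] a_int W_int by (simp add: o_def)
  have bound_int: "integrable M (\<lambda>\<omega>. h \<omega> * f \<omega>)"
    if "integrable M f" "h \<in> borel_measurable M" "\<And>\<omega>. \<omega> \<in> space M \<Longrightarrow> \<bar>h \<omega>\<bar> \<le> C"
    for f h :: "'a \<Rightarrow> real"
  proof (rule Bochner_Integration.integrable_bound[OF integrable_mult_right[of C, OF integrable_abs[OF that(1)]]])
    show "(\<lambda>\<omega>. h \<omega> * f \<omega>) \<in> borel_measurable M"
      using that by measurable
    show "AE \<omega> in M. norm (h \<omega> * f \<omega>) \<le> norm (C * \<bar>f \<omega>\<bar>)"
    proof (intro AE_I2)
      fix \<omega> assume "\<omega> \<in> space M"
      then have "\<bar>h \<omega>\<bar> \<le> \<bar>C\<bar>" using that(3) by fastforce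
      then show "norm (h \<omega> * f \<omega>) \<le> norm (C * \<bar>f \<omega>\<bar>)"
        by (simp add: abs_mult mult_right_mono)
    qed
  qed
  have WF: "integrable M (\<lambda>\<omega>. F c (V \<omega>) * W (V \<omega>))"
    by (rule bound_int[OF W_int]) (auto simp: bdd V)
  have "expectation (\<lambda>\<omega>. a (U \<omega>) * (F c (V \<omega>) * W (V \<omega>)))
      = expectation (\<lambda>\<omega>. a (U \<omega>)) * expectation (\<lambda>\<omega>. F c (V \<omega>) * W (V \<omega>))"
    using indep_var_lebesgue_integral[OF ind2] a_int WF by (simp add: o_def)
  then have "0 = expectation (\<lambda>\<omega>. F c (V \<omega>) * (a (U \<omega>) * W (V \<omega>)))"
    by (simp add: a_mean ac_simps)
  also have "\<dots> \<le> expectation (\<lambda>\<omega>. F (U \<omega>) (V \<omega>) * (a (U \<omega>) * W (V \<omega>)))"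
  proof (rule integral_mono)
    show "integrable M (\<lambda>\<omega>. F c (V \<omega>) * (a (U \<omega>) * W (V \<omega>)))"
      by (rule bound_int[OF aW_int]) (auto simp: bdd V)
    show "integrable M (\<lambda>\<omega>. F (U \<omega>) (V \<omega>) * (a (U \<omega>) * W (V \<omega>)))"
      by (rule bound_int[OF aW_int]) (auto simp: bdd V)
    fix \<omega> assume "\<omega> \<in> space M"
    from mult_right_mono[OF cross[OF V[OF this]] W_nonneg[of "V \<omega>"]]
    show "F c (V \<omega>) * (a (U \<omega>) * W (V \<omega>)) \<le> F (U \<omega>) (V \<omega>) * (a (U \<omega>) * W (V \<omega>))"
      by (simp add: mult.assoc)
  qed
  finally show ?thesis .
qed

text \<open>A hybrid argument: the weights \<open>w\<close> are replaced by \<open>w'\<close> one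
  index at a time. Each exchange is the single-crossing inequality with coordinate \<open>j\<close>
  as \<open>U\<close>, the other coordinates as \<open>V\<close> and the product of their current
  weights as \<open>W\<close>.\<close>

lemma (in prob_space) indep_reweighting_mono:
  fixes D :: "'i \<Rightarrow> 'a \<Rightarrow> real" and F :: "('i \<Rightarrow> real) \<Rightarrow> real"
    and w w' :: "'i \<Rightarrow> real \<Rightarrow> real"
  assumes ind: "indep_vars (\<lambda>_. borel) D I" and I: "finite I" and K: "K \<subseteq> I"
    and F [measurable]: "F \<in> borel_measurable (PiM I (\<lambda>_. borel))"
    and bdd: "\<And>d. \<bar>F d\<bar> \<le> C"
    and mono: "\<And>d e. (\<And>i. i \<in> I \<Longrightarrow> d i \<le> e i) \<Longrightarrow> F d \<le> F e"
    and meas [measurable]: "\<And>i. w i \<in> borel_measurable borel" "\<And>i. w' i \<in> borel_measurable borel"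
    and nonneg: "\<And>i x. 0 \<le> w i x" "\<And>i x. 0 \<le> w' i x"
    and int: "\<And>i. i \<in> K \<Longrightarrow> integrable M (\<lambda>\<omega>. w i (D i \<omega>))"
      "\<And>i. i \<in> K \<Longrightarrow> integrable M (\<lambda>\<omega>. w' i (D i \<omega>))"
    and mean: "\<And>i. i \<in> K \<Longrightarrow> expectation (\<lambda>\<omega>. w i (D i \<omega>)) = expectation (\<lambda>\<omega>. w' i (D i \<omega>))"
    and cross: "\<And>i x. x \<le> c i \<Longrightarrow> w' i x \<le> w i x" "\<And>i x. c i \<le> x \<Longrightarrow> w i x \<le> w' i x"
  shows "expectation (\<lambda>\<omega>. F (\<lambda>i\<in>I. D i \<omega>) * (\<Prod>i\<in>K. w i (D i \<omega>)))
      \<le> expectation (\<lambda>\<omega>. F (\<lambda>i\<in>I. D i \<omega>) * (\<Prod>i\<in>K. w' i (D i \<omega>)))"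
proof -
  have finK: "finite K" using I K by (rule rev_finite_subset)
  have D [measurable]: "D i \<in> borel_measurable M" if "i \<in> I" for i
    using ind that by (simp add: indep_vars_def)
  have DI [measurable]: "(\<lambda>\<omega>. \<lambda>i\<in>I. D i \<omega>) \<in> measurable M (PiM I (\<lambda>_. borel))"
    by (rule measurable_restrict) simp
  \<comment> \<open>\<open>L\<close> collects the indices whose weight has already been
    exchanged.\<close>
  define v where "v L i x = (if i \<in> L then w' i x else w i x)" for L i x
  have v_meas [measurable]: "v L i \<in> borel_measurable borel" for L i
    by (cases "i \<in> L") (simp_all add: v_def [abs_def])
  have v_nonneg: "0 \<le> v L i x" for L i x
    by (simp add: v_def nonneg)
  have v_int: "integrable M (\<lambda>\<omega>. v L i (D i \<omega>))" if "i \<in> K" for L i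
    using that by (cases "i \<in> L") (simp_all add: v_def int)
  have prod_int: "integrable M (\<lambda>\<omega>. \<Prod>i\<in>J. v L i (D i \<omega>))" if "J \<subseteq> K" for J L
  proof (rule indep_vars_integrable)
    show "finite J" using that finK by (rule finite_subset)
    show "indep_vars (\<lambda>_. borel) (\<lambda>i \<omega>. v L i (D i \<omega>)) J"
      using that K by (intro indep_vars_compose2[OF indep_vars_subset[OF ind]]) auto
  qed (use that v_int in auto)
  have F_int: "integrable M (\<lambda>\<omega>. F (\<lambda>i\<in>I. D i \<omega>) * (\<Prod>i\<in>K. v L i (D i \<omega>)))" for L
  proof (rule Bochner_Integration.integrable_bound[OF integrable_mult_right[of C, OF prod_int[of K L]]])
    show "(\<lambda>\<omega>. F (\<lambda>i\<in>I. D i \<omega>) * (\<Prod>i\<in>K. v L i (D i \<omega>))) \<in> borel_measurable M"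
      using borel_measurable_integrable[OF prod_int[of K L]] by measurable
    show "AE \<omega> in M. norm (F (\<lambda>i\<in>I. D i \<omega>) * (\<Prod>i\<in>K. v L i (D i \<omega>)))
        \<le> norm (C * (\<Prod>i\<in>K. v L i (D i \<omega>)))"
      using order_trans[OF bdd abs_ge_self] by (intro AE_I2) (auto simp: abs_mult intro!: mult_right_mono)
  qed simp
  have "expectation (\<lambda>\<omega>. F (\<lambda>i\<in>I. D i \<omega>) * (\<Prod>i\<in>K. v {} i (D i \<omega>)))
      \<le> expectation (\<lambda>\<omega>. F (\<lambda>i\<in>I. D i \<omega>) * (\<Prod>i\<in>K. v L i (D i \<omega>)))" if "L \<subseteq> K" for L
    using finite_subset[OF that finK] that
  proof (induction L rule: finite_induct)
    case (insert j L)
    then have j: "j \<in> K" "j \<in> I" "j \<notin> L" using K by auto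
    let ?N = "PiM (I - {j}) (\<lambda>_. borel :: real measure)"
    let ?V = "\<lambda>\<omega>. \<lambda>i\<in>I - {j}. D i \<omega>"
    let ?W = "\<lambda>y. \<Prod>i\<in>K - {j}. v L i (y i)"
    \<comment> \<open>The single coordinate is kept as a function on \<open>{j}\<close>:
      \<open>indep_var\<close> takes two variables with values in the same type, and
      \<open>?V\<close> is function-valued.\<close>
    let ?L = "PiM {j} (\<lambda>_. borel :: real measure)"
    let ?U = "\<lambda>\<omega>. \<lambda>i\<in>{j}. D i \<omega>"
    have ind_j: "indep_var ?L ?U ?N ?V"
      using j by (intro indep_var_restrict[OF ind]) auto
    have split: "(\<Prod>i\<in>K. v L' i (D i \<omega>)) = v L' j (D j \<omega>) * (\<Prod>i\<in>K - {j}. v L' i (D i \<omega>))" for L' \<omega>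
      using finK j by (simp add: prod.remove)
    \<comment> \<open>The two hybrids differ only at \<open>j\<close>, so off \<open>j\<close> they
      have the same product of weights.\<close>
    have W_eq: "(\<Prod>i\<in>K - {j}. v (insert j L) i (D i \<omega>)) = ?W (?V \<omega>)"
       "(\<Prod>i\<in>K - {j}. v L i (D i \<omega>)) = ?W (?V \<omega>)" for \<omega>
      by (auto intro!: prod.cong simp: v_def subsetD[OF K])
    have upd: "(?V \<omega>)(j := ?U \<omega> j) = (\<lambda>i\<in>I. D i \<omega>)" for \<omega>
      using j by (auto simp: fun_eq_iff)
    have "0 \<le> expectation (\<lambda>\<omega>. F ((?V \<omega>)(j := ?U \<omega> j)) * ((w' j (?U \<omega> j) - w j (?U \<omega> j)) * ?W (?V \<omega>)))"
    proof (rule indep_single_crossing_nonneg[OF ind_j, where c = "\<lambda>i\<in>{j}. c j" and C = C])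
      have "(\<lambda>(u, y). y(j := u j)) \<in> measurable (?L \<Otimes>\<^sub>M ?N) (PiM (insert j (I - {j})) (\<lambda>_. borel))"
        by measurable
      moreover have "insert j (I - {j}) = I" using j by auto
      ultimately have "(\<lambda>(u, y). y(j := u j)) \<in> measurable (?L \<Otimes>\<^sub>M ?N) (PiM I (\<lambda>_. borel))"
        by simp
      from measurable_compose[OF this F]
      show "(\<lambda>(u, y). F (y(j := u j))) \<in> borel_measurable (?L \<Otimes>\<^sub>M ?N)"
        by (simp add: case_prod_beta)
      have "(\<lambda>y. v L i (y i)) \<in> borel_measurable ?N" if "i \<in> K - {j}" for i
      proof -
        have [measurable]: "i \<in> I - {j}" using that K by auto
        show ?thesis by measurable
      qed
      then show "?W \<in> borel_measurable ?N"
        by (intro borel_measurable_prod) auto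
      have "integrable M (\<lambda>\<omega>. \<Prod>i\<in>K - {j}. v L i (D i \<omega>))"
        by (rule prod_int) auto
      then show "integrable M (\<lambda>\<omega>. ?W (?V \<omega>))"
        using W_eq(2) by simp
      show "(\<lambda>u. w' j (u j) - w j (u j)) \<in> borel_measurable ?L"
        by measurable
      \<comment> \<open>Right of \<open>c j\<close> the value of \<open>F\<close> does not fall and
        the weight difference is nonnegative. Left of it \<open>F\<close> does not rise and the
        difference is nonpositive, so multiplication restores the direction of the
        inequality.\<close>
      show "F (y(j := (\<lambda>i\<in>{j}. c j) j)) * (w' j (u j) - w j (u j))
          \<le> F (y(j := u j)) * (w' j (u j) - w j (u j))" for u y
      proof (cases "c j \<le> u j")
        case True
        then show ?thesis
          using cross by (intro mult_right_mono mono) auto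
      next
        case False
        then show ?thesis
          using cross by (intro mult_right_mono_neg mono) auto
      qed
    qed (use j bdd v_nonneg int mean in \<open>auto intro!: prod_nonneg simp: space_PiM\<close>)
    also have "\<dots> = expectation (\<lambda>\<omega>. F (\<lambda>i\<in>I. D i \<omega>) * (\<Prod>i\<in>K. v (insert j L) i (D i \<omega>))
          - F (\<lambda>i\<in>I. D i \<omega>) * (\<Prod>i\<in>K. v L i (D i \<omega>)))"
      unfolding upd split W_eq using j(3) by (simp add: v_def algebra_simps)
    also have "\<dots> = expectation (\<lambda>\<omega>. F (\<lambda>i\<in>I. D i \<omega>) * (\<Prod>i\<in>K. v (insert j L) i (D i \<omega>)))
          - expectation (\<lambda>\<omega>. F (\<lambda>i\<in>I. D i \<omega>) * (\<Prod>i\<in>K. v L i (D i \<omega>)))"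
      by (rule Bochner_Integration.integral_diff[OF F_int F_int])
    finally have step: "expectation (\<lambda>\<omega>. F (\<lambda>i\<in>I. D i \<omega>) * (\<Prod>i\<in>K. v L i (D i \<omega>)))
        \<le> expectation (\<lambda>\<omega>. F (\<lambda>i\<in>I. D i \<omega>) * (\<Prod>i\<in>K. v (insert j L) i (D i \<omega>)))"
      by (simp only: diff_ge_0_iff_ge)
    have "L \<subseteq> K" using insert.prems by simp
    from order_trans[OF insert.IH[OF this] step] show ?case .
  qed simp
  from this[of K] show ?thesis
    by (simp add: v_def)
qed

text \<open>The hypothesis separates one increment from the past. Joint independence follows by
  induction along the grid: \<open>D 0\<close> to \<open>D n\<close> are functions of the path up to
  \<open>s n\<close>, so the event of the next increment splits off. The starting value
  \<open>X (s 0)\<close> counts as the increment of index 0.\<close>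

lemma (in prob_space) indep_vars_grid_increments:
  fixes X :: "real \<Rightarrow> 'a \<Rightarrow> real" and s :: "nat \<Rightarrow> real"
  assumes meas: "\<And>t. t \<in> {0..T} \<Longrightarrow> X t \<in> borel_measurable M"
    and incr: "independent_increments M T X"
    and s: "mono s" "\<And>i. s i \<in> {0..T}"
  shows "indep_vars (\<lambda>_. borel) (\<lambda>i \<omega>. case i of 0 \<Rightarrow> X (s 0) \<omega> | Suc j \<Rightarrow> X (s (Suc j)) \<omega> - X (s j) \<omega>) {..n}"
proof -
  define D where "D i = (\<lambda>\<omega>. case i of 0 \<Rightarrow> X (s 0) \<omega> | Suc j \<Rightarrow> X (s (Suc j)) \<omega> - X (s j) \<omega>)" for i
  define G where "G i = {D i -` A \<inter> space M | A. A \<in> sets borel}" for i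
  have D_meas: "D i \<in> borel_measurable M" for i
    using meas s(2) by (cases i) (auto simp: D_def [abs_def] intro!: borel_measurable_diff)
  have G_sets: "G i \<subseteq> events" for i
    using D_meas[of i] by (auto simp: G_def measurable_sets)
  have past: "G j \<subseteq> generated_sigma M {0..s n} X" if "j \<le> n" for j n
  proof -
    define E where "E = (\<Union>u\<in>{0..s n}. {X u -` A \<inter> space M | A. A \<in> sets borel})"
    have E: "E \<subseteq> Pow (space M)" by (auto simp: E_def)
    have X_sigma: "X u \<in> borel_measurable (sigma (space M) E)" if "u \<in> {0..s n}" for u
    proof (rule measurableI)
      fix A :: "real set" assume "A \<in> sets borel"
      then have "X u -` A \<inter> space M \<in> E" using that unfolding E_def by blast
      then show "X u -` A \<inter> space (sigma (space M) E) \<in> sets (sigma (space M) E)"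
        using E by (simp add: space_measure_of)
    qed simp
    have le: "s i \<in> {0..s n}" if "i \<le> n" for i
      using that s by (auto simp: monoD)
    have "D j \<in> borel_measurable (sigma (space M) E)"
      using X_sigma le \<open>j \<le> n\<close> by (cases j) (auto simp: D_def [abs_def] intro!: borel_measurable_diff)
    from measurable_sets[OF this] show ?thesis
      using E by (auto simp: G_def generated_sigma_def E_def [symmetric] space_measure_of)
  qed
  have prod: "prob (\<Inter>j\<in>{..n}. A j) = (\<Prod>j\<in>{..n}. prob (A j))" if "\<And>j. A j \<in> G j" for A n
  proof (induction n)
    case (Suc n)
    have "0 \<le> s n" "s n \<le> s (Suc n)" "s (Suc n) \<le> T"
      using s by (auto simp: monoD)
    then have ind: "indep_set (sets (vimage_algebra (space M) (\<lambda>\<omega>. X (s (Suc n)) \<omega> - X (s n) \<omega>) borel))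
        (generated_sigma M {0..s n} X)"
      using incr by (simp add: independent_increments_def)
    have "A (Suc n) \<in> sets (vimage_algebra (space M) (\<lambda>\<omega>. X (s (Suc n)) \<omega> - X (s n) \<omega>) borel)"
      using that[of "Suc n"] by (auto simp: G_def D_def sets_vimage_algebra2)
    moreover have "(\<Inter>j\<in>{..n}. A j) \<in> generated_sigma M {0..s n} X"
    proof -
      interpret sigma_algebra "space M" "generated_sigma M {0..s n} X"
        unfolding generated_sigma_def by (rule sigma_algebra_sigma_sets) auto
      show ?thesis using past that by (intro finite_INT) auto
    qed
    ultimately have "prob (A (Suc n) \<inter> (\<Inter>j\<in>{..n}. A j)) = prob (A (Suc n)) * prob (\<Inter>j\<in>{..n}. A j)"
      by (rule indep_setD[OF ind])
    then show ?case using Suc by (simp add: atMost_Suc)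
  qed simp
  \<comment> \<open>Every \<open>G i\<close> contains \<open>space M\<close>, so the product formula
    for the full index set already gives it for all subsets.\<close>
  have "indep_sets G {..n}"
  proof (subst indep_sets_finite)
    show "\<forall>A\<in>Pi {..n} G. prob (\<Inter>j\<in>{..n}. A j) = (\<Prod>j\<in>{..n}. prob (A j))"
    proof
      fix A assume A: "A \<in> Pi {..n} G"
      have G: "space M \<in> G i" for i by (auto simp: G_def intro!: exI[of _ UNIV])
      \<comment> \<open>The formula \<open>prod\<close> wants members of \<open>G\<close> at all
        indices, while \<open>A\<close> is constrained only up to \<open>n\<close>; beyond that it
        is padded with \<open>space M\<close>.\<close>
      have "prob (\<Inter>j\<in>{..n}. A j) = prob (\<Inter>j\<in>{..n}. if j \<le> n then A j else space M)"
        by (intro arg_cong[where f = prob]) auto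
      also have "\<dots> = (\<Prod>j\<in>{..n}. prob (if j \<le> n then A j else space M))"
        using A G by (intro prod) auto
      finally show "prob (\<Inter>j\<in>{..n}. A j) = (\<Prod>j\<in>{..n}. prob (A j))" by simp
    qed
  qed (use G_sets in \<open>auto simp: G_def intro!: exI[of _ UNIV]\<close>)
  then have "indep_vars (\<lambda>_. borel) D {..n}"
    using D_meas by (simp add: indep_vars_def2 G_def [abs_def])
  then show ?thesis by (simp add: D_def [abs_def])
qed

subsection \<open>Convex functions as test functions\<close>

text \<open>Chord slopes of a convex function grow when either endpoint moves right. The chord is
  first translated from \<open>x\<close> to \<open>y\<close>, by comparison with the chord from
  \<open>x\<close> to \<open>y + h\<close>, and then lengthened.\<close>

lemma convex_difference_quotient_mono:
  fixes \<phi> :: "real \<Rightarrow> real"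
  assumes "convex_on UNIV \<phi>" and "0 < h" "h \<le> h'" "x \<le> y"
  shows "(\<phi> (x + h) - \<phi> x) / h \<le> (\<phi> (y + h') - \<phi> y) / h'"
proof -
  have flip: "(p - q) / (r - s) = (q - p) / (s - r)" for p q r s :: real
    by (metis minus_diff_eq minus_divide_divide)
  have slope: "(\<phi> b - \<phi> a) / (b - a) \<le> (\<phi> c - \<phi> a) / (c - a)"
    "(\<phi> c - \<phi> a) / (c - a) \<le> (\<phi> c - \<phi> b) / (c - b)" if "a < b" "b < c" for a b c
    unfolding flip[of "\<phi> b" "\<phi> a" b a] flip[of "\<phi> c" "\<phi> a" c a] flip[of "\<phi> c" "\<phi> b" c b]
    using convex_on_slope_le[OF assms(1) UNIV_I UNIV_I that] by auto
  have "(\<phi> (x + h) - \<phi> x) / h \<le> (\<phi> (y + h) - \<phi> y) / h"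
  proof (cases "x = y")
    case False
    with assms slope[of x "x + h" "y + h"] slope[of x y "y + h"] show ?thesis by simp
  qed simp
  also have "\<dots> \<le> (\<phi> (y + h') - \<phi> y) / h'"
    using assms slope(1)[of y "y + h" "y + h'"] by (cases "h = h'") auto
  finally show ?thesis .
qed

text \<open>The quotients with step \<open>1 / real (Suc k)\<close> decrease in \<open>k\<close> and
  stay above the chord slopes to the left of \<open>x\<close>, so they converge to the right
  derivative, the slope of a supporting line. The quotients appear in the conclusion because they
  are continuous in \<open>x\<close>, unlike \<open>g\<close> in general.\<close>

lemma convex_right_derivative:
  fixes \<phi> :: "real \<Rightarrow> real"
  assumes \<phi>: "convex_on UNIV \<phi>"
  obtains g where "\<And>x. (\<lambda>k. (\<phi> (x + 1 / real (Suc k)) - \<phi> x) / (1 / real (Suc k))) \<longlonglongrightarrow> g x"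
    and "\<And>x y. \<phi> x + g x * (y - x) \<le> \<phi> y"
proof -
  define q where "q k x = (\<phi> (x + 1 / real (Suc k)) - \<phi> x) / (1 / real (Suc k))" for k x
  have below: "(\<phi> x - \<phi> y) / (x - y) \<le> q k x" if "y < x" for x y k
  proof -
    define z where "z = x + 1 / real (Suc k)"
    have "x < z" by (simp add: z_def)
    have "(\<phi> y - \<phi> x) / (y - x) \<le> (\<phi> x - \<phi> z) / (x - z)"
      using convex_on_slope_le[OF \<phi> UNIV_I UNIV_I that \<open>x < z\<close>] by (rule order_trans)
    moreover have "(\<phi> y - \<phi> x) / (y - x) = (\<phi> x - \<phi> y) / (x - y)"
      "(\<phi> x - \<phi> z) / (x - z) = (\<phi> z - \<phi> x) / (z - x)"
      by (metis minus_diff_eq minus_divide_divide)+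
    moreover have "q k x = (\<phi> z - \<phi> x) / (z - x)" by (simp add: q_def z_def)
    ultimately show ?thesis by simp
  qed
  have dec: "decseq (\<lambda>k. q k x)" for x
    unfolding q_def decseq_def
    by (intro allI impI convex_difference_quotient_mono[OF \<phi>] frac_le order_refl) auto
  have "\<exists>l. (\<lambda>k. q k x) \<longlonglongrightarrow> l" for x
    by (rule decseq_convergent[OF dec[of x], of "(\<phi> x - \<phi> (x - 1)) / (x - (x - 1))"])
      (use below[of "x - 1" x] in auto)
  then obtain g where g: "\<And>x. (\<lambda>k. q k x) \<longlonglongrightarrow> g x" by metis
  have "\<phi> x + g x * (y - x) \<le> \<phi> y" for x y
  proof (cases x y rule: linorder_cases)
    case less
    have "eventually (\<lambda>k. 1 / real (Suc k) < y - x) sequentially"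
      using order_tendstoD(2)[OF LIMSEQ_inverse_real_of_nat, of "y - x"] less by (simp add: inverse_eq_divide)
    then have "eventually (\<lambda>k. q k x \<le> (\<phi> y - \<phi> x) / (y - x)) sequentially"
    proof eventually_elim
      case (elim k)
      with convex_difference_quotient_mono[OF \<phi>, of "1 / real (Suc k)" "y - x" x x] show ?case
        by (simp add: q_def)
    qed
    then have "g x \<le> (\<phi> y - \<phi> x) / (y - x)"
      by (rule tendsto_upperbound[OF g]) simp
    with less show ?thesis by (simp add: field_simps)
  next
    case greater
    have "(\<phi> x - \<phi> y) / (x - y) \<le> g x"
      by (rule LIMSEQ_le_const[OF g]) (use below[OF greater] in auto)
    with greater show ?thesis by (simp add: field_simps)
  qed simp
  with g show thesis by (intro that) (auto simp: q_def)
qed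

text \<open>The negative part of \<open>p + l\<close> is at most that of \<open>l\<close>, so
  infinities are never subtracted; if \<open>p\<close> is not integrable, both sides are plus
  infinity. Splitting off an integrable minorant thus reduces extended expectations to nonnegative
  integrals.\<close>

lemma ext_expectation_nonneg_plus_integrable:
  assumes p [measurable]: "p \<in> borel_measurable M" and nonneg: "\<And>\<omega>. 0 \<le> p \<omega>" and l: "integrable M l"
  shows "ext_expectation M (\<lambda>\<omega>. p \<omega> + l \<omega>) = enn2ereal (\<integral>\<^sup>+\<omega>. ennreal (p \<omega>) \<partial>M) + ereal (integral\<^sup>L M l)"
proof (cases "integrable M p")
  case True
  have fin: "integrable M (\<lambda>\<omega>. p \<omega> + l \<omega>)" using True l by simp
  then have "(\<integral>\<^sup>+\<omega>. ennreal (p \<omega> + l \<omega>) \<partial>M) < \<infinity>" "(\<integral>\<^sup>+\<omega>. ennreal (- (p \<omega> + l \<omega>)) \<partial>M) < \<infinity>"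
    unfolding real_integrable_def by (auto simp: less_top [symmetric])
  then have "ext_expectation M (\<lambda>\<omega>. p \<omega> + l \<omega>) = ereal (\<integral>\<omega>. p \<omega> + l \<omega> \<partial>M)"
    unfolding ext_expectation_def real_lebesgue_integral_def[OF fin]
    by (cases "\<integral>\<^sup>+\<omega>. ennreal (p \<omega> + l \<omega>) \<partial>M"; cases "\<integral>\<^sup>+\<omega>. ennreal (- (p \<omega> + l \<omega>)) \<partial>M")
      (auto simp: enn2ereal_ennreal)
  also have "\<dots> = ereal (integral\<^sup>L M p) + ereal (integral\<^sup>L M l)"
    using True l by simp
  also have "ereal (integral\<^sup>L M p) = enn2ereal (\<integral>\<^sup>+\<omega>. ennreal (p \<omega>) \<partial>M)"
    using nonneg by (simp add: nn_integral_eq_integral[OF True] enn2ereal_ennreal)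
  finally show ?thesis .
next
  case False
  have [measurable]: "l \<in> borel_measurable M" using l by simp
  have top: "(\<integral>\<^sup>+\<omega>. ennreal (p \<omega>) \<partial>M) = \<infinity>"
    using False nonneg integrableI_nonneg[OF p] by (auto simp: less_top [symmetric])
  have l_fin: "(\<integral>\<^sup>+\<omega>. ennreal (- l \<omega>) \<partial>M) < \<infinity>"
    using l unfolding real_integrable_def by (auto simp: less_top [symmetric])
  have neg: "(\<integral>\<^sup>+\<omega>. ennreal (- (p \<omega> + l \<omega>)) \<partial>M) \<le> (\<integral>\<^sup>+\<omega>. ennreal (- l \<omega>) \<partial>M)"
    using nonneg by (intro nn_integral_mono ennreal_leI) auto
  \<comment> \<open>\<open>p\<close> is at most the positive part of \<open>p + l\<close> plus the
    negative part of \<open>l\<close>. The latter has a finite integral, so the former must have an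
    infinite one.\<close>
  have "(\<integral>\<^sup>+\<omega>. ennreal (p \<omega>) \<partial>M) \<le> (\<integral>\<^sup>+\<omega>. ennreal (p \<omega> + l \<omega>) + ennreal (- l \<omega>) \<partial>M)"
  proof (intro nn_integral_mono)
    fix \<omega>
    have "p \<omega> \<le> max 0 (p \<omega> + l \<omega>) + max 0 (- l \<omega>)" by auto
    then have "ennreal (p \<omega>) \<le> ennreal (max 0 (p \<omega> + l \<omega>) + max 0 (- l \<omega>))" by (rule ennreal_leI)
    then show "ennreal (p \<omega>) \<le> ennreal (p \<omega> + l \<omega>) + ennreal (- l \<omega>)"
      by (subst (asm) ennreal_plus) (auto simp: max_def ennreal_neg split: if_splits)
  qed
  also have "\<dots> = (\<integral>\<^sup>+\<omega>. ennreal (p \<omega> + l \<omega>) \<partial>M) + (\<integral>\<^sup>+\<omega>. ennreal (- l \<omega>) \<partial>M)"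
    by (rule nn_integral_add) auto
  finally have "(\<integral>\<^sup>+\<omega>. ennreal (p \<omega> + l \<omega>) \<partial>M) = \<infinity>"
    using top l_fin by (auto simp: less_top [symmetric] top_unique)
  moreover have "(\<integral>\<^sup>+\<omega>. ennreal (- (p \<omega> + l \<omega>)) \<partial>M) < \<infinity>"
    using neg l_fin by (rule le_less_trans)
  ultimately show ?thesis
    unfolding ext_expectation_def top
    by (cases "\<integral>\<^sup>+\<omega>. ennreal (- (p \<omega> + l \<omega>)) \<partial>M") (auto simp: enn2ereal_ennreal)
qed

text \<open>The right derivative of \<phi> may be unbounded and discontinuous, while
  \<open>test\<close> admits bounded continuous functions only. Truncation at \<open>m\<close> makes
  the slope bounded, and the quotients \<open>q k\<close> make it continuous. The limit in
  \<open>k\<close> is taken by dominated convergence, the one in \<open>m\<close> by Fatou's lemma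
  after subtraction of a supporting line.\<close>

lemma (in prob_space) ext_expectation_convex_mono:
  fixes Y Z :: "'a \<Rightarrow> real"
  assumes Y: "integrable M Y" and Z: "integrable M Z"
    and test: "\<And>g B. continuous_on UNIV g \<Longrightarrow> mono g \<Longrightarrow> (\<And>x. \<bar>g x\<bar> \<le> B) \<Longrightarrow>
      0 \<le> expectation (\<lambda>\<omega>. g (Y \<omega>) * (Z \<omega> - Y \<omega>))"
    and \<phi>: "convex_on UNIV \<phi>"
  shows "ext_expectation M (\<lambda>\<omega>. \<phi> (Y \<omega>)) \<le> ext_expectation M (\<lambda>\<omega>. \<phi> (Z \<omega>))"
proof -
  have [measurable]: "Y \<in> borel_measurable M" "Z \<in> borel_measurable M"
    using Y Z by auto
  have \<phi>_cont: "continuous_on UNIV \<phi>"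
    using \<phi> by (rule convex_on_continuous[OF open_UNIV])
  have \<phi>_meas [measurable]: "\<phi> \<in> borel_measurable borel"
    using \<phi>_cont by (rule borel_measurable_continuous_onI)
  \<comment> \<open>The constants 1 and -1 are both admissible in \<open>test\<close>, which forces
    equal means.\<close>
  have mean: "expectation Y = expectation Z"
    using test[of "\<lambda>_. 1" 1] test[of "\<lambda>_. -1" 1] Y Z by (auto simp: mono_def)
  define q where "q k x = (\<phi> (x + 1 / real (Suc k)) - \<phi> x) / (1 / real (Suc k))" for k x
  obtain g where q_lim: "\<And>x. (\<lambda>k. q k x) \<longlonglongrightarrow> g x" and sub: "\<And>x y. \<phi> x + g x * (y - x) \<le> \<phi> y"
    using convex_right_derivative[OF \<phi>] unfolding q_def by blast
  have q_cont: "continuous_on UNIV (q k)" for k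
    unfolding q_def [abs_def] by (intro continuous_intros continuous_on_compose2[OF \<phi>_cont]) auto
  have q_meas [measurable]: "q k \<in> borel_measurable borel" for k
    using q_cont by (rule borel_measurable_continuous_onI)
  have g_meas [measurable]: "g \<in> borel_measurable borel"
    by (rule borel_measurable_LIMSEQ_real[OF q_lim q_meas])
  have q_mono: "q k x \<le> q k y" if "x \<le> y" for k x y
    unfolding q_def using that by (intro convex_difference_quotient_mono[OF \<phi>]) auto
  have g_mono: "g x \<le> g y" if "x \<le> y" for x y
    using q_mono[OF that] by (intro LIMSEQ_le[OF q_lim q_lim]) auto
  define c where "c m x = max (- real m) (min (real m) x)" for m x
  have c_cont: "continuous_on UNIV (c m)" for m
    unfolding c_def [abs_def] by (intro continuous_intros)
  have c_meas [measurable]: "c m \<in> borel_measurable borel" for m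
    using c_cont by (rule borel_measurable_continuous_onI)
  \<comment> \<open>\<open>\<phi>\<close> on \<open>[-m, m]\<close>, continued linearly with slopes \<open>g (- m)\<close> and \<open>g m\<close>\<close>
  define \<psi> where "\<psi> m x = \<phi> (c m x) + g (c m x) * (x - c m x)" for m x
  \<comment> \<open>Slopes on \<open>[-m, m]\<close> lie between that of the chord of length 1 left
    of \<open>-m\<close> and that of the chord of length 1 right of \<open>m\<close>.\<close>
  define B where "B m = \<bar>\<phi> (- real m) - \<phi> (- real m - 1)\<bar> + \<bar>\<phi> (real m + 1) - \<phi> (real m)\<bar>" for m
  have q_bound: "\<bar>q k (c m x)\<bar> \<le> B m" for k m x
  proof -
    have "q k (c m x) \<le> (\<phi> (real m + 1) - \<phi> (real m)) / 1"
      unfolding q_def by (intro convex_difference_quotient_mono[OF \<phi>]) (auto simp: c_def)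
    moreover have "\<phi> (- real m) - \<phi> (- real m - 1) \<le> g (- real m)"
      using sub[of "- real m" "- real m - 1"] by simp
    moreover have "g (- real m) \<le> g (c m x)"
      by (rule g_mono) (simp add: c_def)
    moreover have "g (c m x) \<le> q k (c m x)"
    proof -
      have "\<phi> (c m x) + g (c m x) * (1 / real (Suc k)) \<le> \<phi> (c m x + 1 / real (Suc k))"
        using sub[of "c m x" "c m x + 1 / real (Suc k)"] by simp
      then show ?thesis by (simp add: q_def field_simps)
    qed
    ultimately show ?thesis by (simp add: B_def)
  qed
  have g_bound: "\<bar>g (c m x)\<bar> \<le> B m" for m x
    by (rule LIMSEQ_le_const2[OF tendsto_rabs[OF q_lim]]) (use q_bound in auto)
  \<comment> \<open>Where \<open>y\<close> is cut off, \<open>y - c m y\<close> points outwards and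
    \<open>g (c m y)\<close> is the extreme slope on that side, so the additional linear term has
    the right sign.\<close>
  have \<psi>_sub: "\<psi> m x + g (c m x) * (y - x) \<le> \<psi> m y" for m x y
  proof -
    have "0 \<le> (g (c m y) - g (c m x)) * (y - c m y)"
    proof (cases "y = c m y")
      case False
      then consider "y < c m y" "c m y \<le> c m x" | "c m y < y" "c m x \<le> c m y"
        by (auto simp: c_def max_def min_def split: if_splits)
      then show ?thesis
      proof cases
        case 1 then show ?thesis using g_mono[of "c m y" "c m x"] by (intro mult_nonpos_nonpos) auto
      next
        case 2 then show ?thesis using g_mono[of "c m x" "c m y"] by (intro mult_nonneg_nonneg) auto
      qed
    qed simp
    with sub[of "c m x" "c m y"] show ?thesis by (simp add: \<psi>_def algebra_simps)
  qed
  have \<psi>_le: "\<psi> m x \<le> \<phi> x" for m x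
    using sub[of "c m x" x] by (simp add: \<psi>_def)
  have \<psi>_lim: "(\<lambda>m. \<psi> m x) \<longlonglongrightarrow> \<phi> x" for x
  proof (rule tendsto_eventually, rule eventually_sequentiallyI)
    fix m assume "nat \<lceil>\<bar>x\<bar>\<rceil> \<le> m"
    then have "c m x = x" by (auto simp: c_def nat_le_iff ceiling_le_iff)
    then show "\<psi> m x = \<phi> x" by (simp add: \<psi>_def)
  qed
  have \<psi>_meas [measurable]: "\<psi> m \<in> borel_measurable borel" for m
    unfolding \<psi>_def [abs_def] by measurable
  have \<psi>_int: "integrable M (\<lambda>\<omega>. \<psi> m (V \<omega>))" if V: "integrable M V" for m V
  proof (rule Bochner_Integration.integrable_bound)
    have [measurable]: "V \<in> borel_measurable M" using V by auto
    show "(\<lambda>\<omega>. \<psi> m (V \<omega>)) \<in> borel_measurable M" by measurable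
    show "integrable M (\<lambda>\<omega>. \<bar>\<psi> m 0\<bar> + B m * \<bar>V \<omega>\<bar>)" using V by simp
    have "\<bar>\<psi> m x\<bar> \<le> \<bar>\<psi> m 0\<bar> + B m * \<bar>x\<bar>" for x
    proof -
      have "\<bar>g (c m x) * x\<bar> \<le> B m * \<bar>x\<bar>" "\<bar>g (c m 0) * x\<bar> \<le> B m * \<bar>x\<bar>"
        by (auto simp: abs_mult g_bound intro!: mult_right_mono)
      with \<psi>_sub[of m x 0] \<psi>_sub[of m 0 x] show ?thesis by simp
    qed
    then show "AE \<omega> in M. norm (\<psi> m (V \<omega>)) \<le> norm (\<bar>\<psi> m 0\<bar> + B m * \<bar>V \<omega>\<bar>)"
      by (intro AE_I2) (simp, meson abs_ge_self order_trans)
  qed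
  have g_int: "integrable M (\<lambda>\<omega>. B m * \<bar>Z \<omega> - Y \<omega>\<bar>)" for m using Y Z by simp
  have bd: "\<bar>b * (Z \<omega> - Y \<omega>)\<bar> \<le> B m * \<bar>Z \<omega> - Y \<omega>\<bar>" if "\<bar>b\<bar> \<le> B m" for b m \<omega>
    using that by (simp add: abs_mult mult_right_mono)
  have g_test: "0 \<le> expectation (\<lambda>\<omega>. g (c m (Y \<omega>)) * (Z \<omega> - Y \<omega>))" for m
  proof (rule LIMSEQ_le_const)
    show "(\<lambda>k. expectation (\<lambda>\<omega>. q k (c m (Y \<omega>)) * (Z \<omega> - Y \<omega>)))
        \<longlonglongrightarrow> expectation (\<lambda>\<omega>. g (c m (Y \<omega>)) * (Z \<omega> - Y \<omega>))"
    proof (rule integral_dominated_convergence[OF _ _ g_int[of m]])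
      show "AE \<omega> in M. (\<lambda>k. q k (c m (Y \<omega>)) * (Z \<omega> - Y \<omega>)) \<longlonglongrightarrow> g (c m (Y \<omega>)) * (Z \<omega> - Y \<omega>)"
        by (intro AE_I2 tendsto_intros q_lim)
    qed (auto intro!: AE_I2 bd q_bound)
    have "0 \<le> expectation (\<lambda>\<omega>. q k (c m (Y \<omega>)) * (Z \<omega> - Y \<omega>))" for k
    proof (rule test[of "\<lambda>y. q k (c m y)" "B m"])
      show "continuous_on UNIV (\<lambda>y. q k (c m y))"
        by (rule continuous_on_compose2[OF q_cont c_cont]) auto
      show "mono (\<lambda>y. q k (c m y))"
        unfolding q_def by (intro monoI convex_difference_quotient_mono[OF \<phi>]) (auto simp: c_def)
    qed (rule q_bound)
    then show "\<exists>N. \<forall>k\<ge>N. 0 \<le> expectation (\<lambda>\<omega>. q k (c m (Y \<omega>)) * (Z \<omega> - Y \<omega>))" by auto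
  qed
  have \<psi>_mono: "expectation (\<lambda>\<omega>. \<psi> m (Y \<omega>)) \<le> expectation (\<lambda>\<omega>. \<psi> m (Z \<omega>))" for m
  proof -
    have "0 \<le> expectation (\<lambda>\<omega>. g (c m (Y \<omega>)) * (Z \<omega> - Y \<omega>))" by (rule g_test)
    also have "\<dots> \<le> expectation (\<lambda>\<omega>. \<psi> m (Z \<omega>) - \<psi> m (Y \<omega>))"
    proof (rule integral_mono)
      show "integrable M (\<lambda>\<omega>. g (c m (Y \<omega>)) * (Z \<omega> - Y \<omega>))"
      proof (rule Bochner_Integration.integrable_bound[OF g_int[of m]])
        show "AE \<omega> in M. norm (g (c m (Y \<omega>)) * (Z \<omega> - Y \<omega>)) \<le> norm (B m * \<bar>Z \<omega> - Y \<omega>\<bar>)"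
          using order_trans[OF bd[OF g_bound] abs_ge_self] by (intro AE_I2) auto
      qed measurable
      show "g (c m (Y \<omega>)) * (Z \<omega> - Y \<omega>) \<le> \<psi> m (Z \<omega>) - \<psi> m (Y \<omega>)" for \<omega>
        using \<psi>_sub[of m "Y \<omega>" "Z \<omega>"] by simp
    qed (use \<psi>_int Y Z in auto)
    finally show ?thesis using \<psi>_int Y Z by simp
  qed
  \<comment> \<open>The supporting line at 0. It lies below every \<open>\<psi> m\<close> as well as
    below \<phi>, because clamping fixes 0.\<close>
  define l where "l x = \<phi> 0 + g 0 * x" for x
  have l_int: "integrable M (\<lambda>\<omega>. l (V \<omega>))" if "integrable M V" for V
    unfolding l_def using that by simp
  have l_mean: "expectation (\<lambda>\<omega>. l (Y \<omega>)) = expectation (\<lambda>\<omega>. l (Z \<omega>))"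
    unfolding l_def using Y Z mean by simp
  have l_\<psi>: "0 \<le> \<psi> m x - l x" for m x
    using \<psi>_sub[of m 0 x] by (simp add: l_def \<psi>_def c_def)
  have l_\<phi>: "0 \<le> \<phi> x - l x" for x
    using sub[of 0 x] by (simp add: l_def)
  have l_meas [measurable]: "l \<in> borel_measurable borel" unfolding l_def [abs_def] by measurable
  have \<psi>_nn: "(\<integral>\<^sup>+\<omega>. ennreal (\<psi> m (V \<omega>) - l (V \<omega>)) \<partial>M)
      = ennreal (expectation (\<lambda>\<omega>. \<psi> m (V \<omega>)) - expectation (\<lambda>\<omega>. l (V \<omega>)))" if "integrable M V" for m V
    using \<psi>_int[OF that] l_int[OF that] l_\<psi> by (subst nn_integral_eq_integral) auto
  \<comment> \<open>Fatou's lemma for the nonnegative \<open>\<psi> m - l\<close> at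
    \<open>Y\<close>; on the side of \<open>Z\<close>, \<open>\<psi> m \<le> \<phi>\<close> gives a
    bound that is constant in \<open>m\<close>.\<close>
  have "(\<integral>\<^sup>+\<omega>. ennreal (\<phi> (Y \<omega>) - l (Y \<omega>)) \<partial>M)
      = (\<integral>\<^sup>+\<omega>. liminf (\<lambda>m. ennreal (\<psi> m (Y \<omega>) - l (Y \<omega>))) \<partial>M)"
    by (intro nn_integral_cong lim_imp_Liminf [symmetric] tendsto_intros \<psi>_lim) auto
  also have "\<dots> \<le> liminf (\<lambda>m. \<integral>\<^sup>+\<omega>. ennreal (\<psi> m (Y \<omega>) - l (Y \<omega>)) \<partial>M)"
    by (rule nn_integral_liminf) measurable
  also have "\<dots> \<le> liminf (\<lambda>m::nat. \<integral>\<^sup>+\<omega>. ennreal (\<phi> (Z \<omega>) - l (Z \<omega>)) \<partial>M)"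
  proof (intro Liminf_mono always_eventually allI)
    fix m
    have "(\<integral>\<^sup>+\<omega>. ennreal (\<psi> m (Y \<omega>) - l (Y \<omega>)) \<partial>M) \<le> (\<integral>\<^sup>+\<omega>. ennreal (\<psi> m (Z \<omega>) - l (Z \<omega>)) \<partial>M)"
      unfolding \<psi>_nn[OF Y] \<psi>_nn[OF Z] using \<psi>_mono[of m] l_mean by (intro ennreal_leI) simp
    also have "\<dots> \<le> (\<integral>\<^sup>+\<omega>. ennreal (\<phi> (Z \<omega>) - l (Z \<omega>)) \<partial>M)"
      using \<psi>_le by (intro nn_integral_mono ennreal_leI) simp
    finally show "(\<integral>\<^sup>+\<omega>. ennreal (\<psi> m (Y \<omega>) - l (Y \<omega>)) \<partial>M)
        \<le> (\<integral>\<^sup>+\<omega>. ennreal (\<phi> (Z \<omega>) - l (Z \<omega>)) \<partial>M)" .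
  qed
  also have "\<dots> = (\<integral>\<^sup>+\<omega>. ennreal (\<phi> (Z \<omega>) - l (Z \<omega>)) \<partial>M)"
    by (rule Liminf_const) simp
  finally have nn: "enn2ereal (\<integral>\<^sup>+\<omega>. ennreal (\<phi> (Y \<omega>) - l (Y \<omega>)) \<partial>M)
      \<le> enn2ereal (\<integral>\<^sup>+\<omega>. ennreal (\<phi> (Z \<omega>) - l (Z \<omega>)) \<partial>M)"
    by (simp add: less_eq_ennreal.rep_eq)
  have ext: "ext_expectation M (\<lambda>\<omega>. \<phi> (V \<omega>))
      = enn2ereal (\<integral>\<^sup>+\<omega>. ennreal (\<phi> (V \<omega>) - l (V \<omega>)) \<partial>M) + ereal (expectation (\<lambda>\<omega>. l (V \<omega>)))"
    if "integrable M V" for V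
  proof -
    have [measurable]: "V \<in> borel_measurable M" using that by auto
    show ?thesis
      using ext_expectation_nonneg_plus_integrable[of "\<lambda>\<omega>. \<phi> (V \<omega>) - l (V \<omega>)", OF _ _ l_int[OF that]] l_\<phi>
      by simp
  qed
  show ?thesis
    unfolding ext[OF Y] ext[OF Z] l_mean using nn by (rule add_right_mono)
qed

subsection \<open>Cadlag paths and grids\<close>

text \<open>The sequence may hit \<open>v\<close> itself, so the limit is taken within
  \<open>{v..}\<close>; the filter \<open>at v within\<close> ignores the centre. At
  \<open>b\<close> the sequence is constant.\<close>

lemma cadlag_on_tendsto_from_right:
  assumes f: "cadlag_on a b f" and v: "v \<in> {a..b}" and r: "\<And>n. r n \<in> {v..b}" "r \<longlonglongrightarrow> v"
  shows "(\<lambda>n. f (r n)) \<longlonglongrightarrow> f v"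
proof (cases "v = b")
  case True
  then have "r n = v" for n using r(1)[of n] by auto
  then show ?thesis by simp
next
  case False
  then have "continuous (at v within {v<..}) f"
    using f v by (auto simp: cadlag_on_def)
  moreover have "at v within {v..} = at v within {v<..}"
    unfolding at_within_def by (rule arg_cong[where f = "\<lambda>S. inf (nhds v) (principal S)"]) auto
  ultimately have "continuous (at v within {v..}) f"
    by (simp add: continuous_within)
  then show ?thesis
    using r unfolding continuous_within_sequentially by (auto simp: o_def)
qed

text \<open>Compactness: one-sided limits bound \<open>f\<close> on both sides of each point, hence
  on a neighbourhood within the interval, and finitely many of these cover it. The local bounds are
  nonnegative, so their sum is a common bound.\<close>

lemma cadlag_on_bounded:
  assumes f: "cadlag_on a b f"
  obtains B where "\<And>t. t \<in> {a..b} \<Longrightarrow> \<bar>f t\<bar> \<le> B"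
proof -
  have bounded: "eventually (\<lambda>x. \<bar>f x\<bar> \<le> \<bar>l\<bar> + 1) F" if "(f \<longlongrightarrow> l) F" for l F
    using order_tendstoD(2)[OF tendsto_rabs[OF that], of "\<bar>l\<bar> + 1"] by (auto elim: eventually_mono)
  have "\<exists>U B. open U \<and> v \<in> U \<and> 0 \<le> B \<and> (\<forall>t\<in>U \<inter> {a..b}. \<bar>f t\<bar> \<le> B)" if v: "v \<in> {a..b}" for v
  proof -
    have "\<exists>l B1. l < v \<and> (\<forall>y\<in>{l<..<v} \<inter> {a..b}. \<bar>f y\<bar> \<le> B1)"
    proof (cases "a < v")
      case True
      then obtain l where "(f \<longlongrightarrow> l) (at_left v)" using f v unfolding cadlag_on_def by force
      from bounded[OF this] show ?thesis
        unfolding eventually_at_left_field by fastforce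
    next
      case False
      then show ?thesis by (intro exI[of _ "v - 1"]) auto
    qed
    then obtain l B1 where l: "l < v" "\<forall>y\<in>{l<..<v} \<inter> {a..b}. \<bar>f y\<bar> \<le> B1" by blast
    have "\<exists>r B2. v < r \<and> (\<forall>y\<in>{v<..<r} \<inter> {a..b}. \<bar>f y\<bar> \<le> B2)"
    proof (cases "v < b")
      case True
      then have "(f \<longlongrightarrow> f v) (at_right v)" using f v by (auto simp: cadlag_on_def continuous_within)
      from bounded[OF this] show ?thesis
        unfolding eventually_at_right_field by fastforce
    next
      case False
      then show ?thesis by (intro exI[of _ "v + 1"]) auto
    qed
    then obtain r B2 where r: "v < r" "\<forall>y\<in>{v<..<r} \<inter> {a..b}. \<bar>f y\<bar> \<le> B2" by blast
    have "\<bar>f y\<bar> \<le> \<bar>B1\<bar> + \<bar>B2\<bar> + \<bar>f v\<bar>" if "y \<in> {l<..<r} \<inter> {a..b}" for y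
      using that l(2) r(2) by (cases y v rule: linorder_cases) force+
    with l(1) r(1) show ?thesis
      by (intro exI[of _ "{l<..<r}"] exI[of _ "\<bar>B1\<bar> + \<bar>B2\<bar> + \<bar>f v\<bar>"]) auto
  qed
  then obtain U B where U: "\<And>v. v \<in> {a..b} \<Longrightarrow> open (U v)" "\<And>v. v \<in> {a..b} \<Longrightarrow> v \<in> U v"
    and B: "\<And>v. v \<in> {a..b} \<Longrightarrow> 0 \<le> B v" "\<And>v t. v \<in> {a..b} \<Longrightarrow> t \<in> U v \<Longrightarrow> t \<in> {a..b} \<Longrightarrow> \<bar>f t\<bar> \<le> B v"
    by (metis IntI)
  obtain C where C: "C \<subseteq> {a..b}" "finite C" "{a..b} \<subseteq> (\<Union>v\<in>C. U v)"
    by (rule compactE_image[of "{a..b}" "{a..b}" U]) (use U in auto)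
  have "\<bar>f t\<bar> \<le> (\<Sum>v\<in>C. B v)" if t: "t \<in> {a..b}" for t
  proof -
    obtain v where v: "v \<in> C" "t \<in> U v" using C(3) t by auto
    then have "\<bar>f t\<bar> \<le> B v" using B(2) C(1) t by auto
    also have "\<dots> \<le> (\<Sum>v\<in>C. B v)" using v C B(1) by (intro member_le_sum) auto
    finally show ?thesis .
  qed
  then show thesis by (rule that)
qed

text \<open>Mesh \<open>T / n\<close>, with \<open>t\<close> inserted as the point of index \<open>n\<close>: the points up to index \<open>n\<close> are
  cut off at \<open>t\<close> from above, those after it from below.\<close>

definition grid :: "real \<Rightarrow> real \<Rightarrow> nat \<Rightarrow> nat \<Rightarrow> real" where
  "grid T t n i = (if i \<le> n then min (real i * T / real n) t
     else min T (max (real (i - n) * T / real n) t))"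

text \<open>The index of a grid point at or to the right of \<open>v\<close>, within one mesh width;
  rounding up fits right continuity. For \<open>v\<close> beyond \<open>t\<close> the index is
  shifted by \<open>n\<close> into the second half of the grid.\<close>

definition grid_index :: "real \<Rightarrow> real \<Rightarrow> nat \<Rightarrow> real \<Rightarrow> nat" where
  "grid_index T t n v = nat \<lceil>v * real n / T\<rceil> + (if v \<le> t then 0 else n)"

lemma mono_grid:
  assumes "0 < T" "t \<in> {0..T}"
  shows "mono (grid T t n)"
proof (rule monoI)
  fix i j :: nat assume "i \<le> j"
  then have "real i * T / real n \<le> real j * T / real n"
    "real (i - n) * T / real n \<le> real (j - n) * T / real n"
    using assms by (auto intro!: divide_right_mono mult_right_mono)
  with assms \<open>i \<le> j\<close> show "grid T t n i \<le> grid T t n j"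
    by (auto simp: grid_def min_le_iff_disj le_max_iff_disj)
qed

lemma grid_in: "0 < T \<Longrightarrow> t \<in> {0..T} \<Longrightarrow> grid T t n i \<in> {0..T}"
  by (auto simp: grid_def min_le_iff_disj le_max_iff_disj)

lemma grid_self: "0 < T \<Longrightarrow> t \<in> {0..T} \<Longrightarrow> 0 < n \<Longrightarrow> grid T t n n = t"
  by (simp add: grid_def)

lemma grid_index:
  assumes T: "0 < T" and v: "v \<in> {0..T}" and n: "0 < n" and t: "0 \<le> t"
  shows grid_index_le: "grid_index T t n v \<le> 2 * n"
    and grid_grid_index: "grid T t n (grid_index T t n v) \<in> {v..v + T / real n}"
proof -
  define j where "j = nat \<lceil>v * real n / T\<rceil>"
  have "0 \<le> v * real n / T" using assms by simp
  then have j: "v * real n / T \<le> real j" "real j < v * real n / T + 1"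
    unfolding j_def by linarith+
  have "v * real n / T \<le> real n" using assms by (simp add: field_simps)
  then have "j \<le> n"
    unfolding j_def by (simp add: nat_le_iff ceiling_le_iff)
  then show "grid_index T t n v \<le> 2 * n" by (simp add: grid_index_def j_def)
  have lo: "v \<le> real j * T / real n" and up: "real j * T / real n \<le> v + T / real n"
    using j assms by (auto simp: field_simps)
  show "grid T t n (grid_index T t n v) \<in> {v..v + T / real n}"
  proof (cases "v \<le> t")
    case True
    then show ?thesis
      using lo up \<open>j \<le> n\<close> by (auto simp: grid_def grid_index_def j_def [symmetric])
  next
    case False
    \<comment> \<open>Strict positivity of \<open>v\<close> gives \<open>j \<ge> 1\<close>, so the
      index exceeds \<open>n\<close> and the second branch of \<open>grid\<close> applies.\<close>
    then have "0 < v * real n / T" using t n T by simp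
    then have "j \<noteq> 0" using j(1) by (intro notI) simp
    with False show ?thesis
      using lo up v T by (auto simp: grid_def grid_index_def j_def [symmetric] min_le_iff_disj le_max_iff_disj)
  qed
qed

lemma measurable_grid_index [measurable]: "grid_index T t n \<in> measurable borel (count_space UNIV)"
  unfolding grid_index_def [abs_def] by measurable

lemma grid_grid_index_tendsto:
  assumes T: "0 < T" and v: "v \<in> {0..T}" and t: "0 \<le> t"
  shows "(\<lambda>n. grid T t (Suc n) (grid_index T t (Suc n) v)) \<longlonglongrightarrow> v"
proof (rule tendsto_sandwich[where f = "\<lambda>_. v" and h = "\<lambda>n. v + T / real (Suc n)"])
  show "(\<lambda>n. v + T / real (Suc n)) \<longlonglongrightarrow> v"
    using tendsto_add[OF tendsto_const[of v] tendsto_mult[OF tendsto_const[of T] LIMSEQ_inverse_real_of_nat]]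
    by (simp add: divide_inverse)
qed (use grid_grid_index[OF T v _ t] in \<open>auto simp del: of_nat_Suc\<close>)

subsection \<open>Averages of exponential martingales\<close>

locale indep_exp_process = prob_space M for M :: "'a measure" +
  fixes T :: real and \<mu> :: "real measure" and X :: "real \<Rightarrow> 'a \<Rightarrow> real"
  assumes T: "0 < T" and finite_mu: "finite_measure \<mu>"
    and sets_mu: "sets \<mu> = sets (restrict_space borel {0..T})"
    and X_meas: "\<And>t. t \<in> {0..T} \<Longrightarrow> X t \<in> borel_measurable M"
    and X_cadlag: "\<And>\<omega>. \<omega> \<in> space M \<Longrightarrow> cadlag_on 0 T (\<lambda>t. X t \<omega>)"
    and X_incr: "independent_increments M T X"
    and X_exp: "\<And>u t. t \<in> {0..T} \<Longrightarrow> integrable M (\<lambda>\<omega>. exp (u * X t \<omega>))"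
    and X_lower: "\<And>u. \<exists>c>0. \<forall>t\<in>{0..T}. c \<le> expectation (\<lambda>\<omega>. exp (u * X t \<omega>))"
begin

section \<open>Exponential weights of mean 1 and the inequality on a finite grid\<close>

definition exp_martingale :: "real \<Rightarrow> real \<Rightarrow> 'a \<Rightarrow> real" where
  "exp_martingale u t \<omega> = exp (u * X t \<omega> - log_mgf M X u t)"

lemma exp_martingale_eq:
  assumes "t \<in> {0..T}"
  shows "exp_martingale u t \<omega> = exp (u * X t \<omega>) / expectation (\<lambda>\<omega>. exp (u * X t \<omega>))"
proof -
  have "0 < expectation (\<lambda>\<omega>. exp (u * X t \<omega>))"
    using X_lower[of u] assms by (auto intro: less_le_trans)
  then show ?thesis by (simp add: exp_martingale_def log_mgf_def exp_diff)
qed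

lemma exp_martingale_integrable:
  assumes "t \<in> {0..T}"
  shows "integrable M (exp_martingale u t)"
  unfolding exp_martingale_eq[OF assms, abs_def] using X_exp[OF assms] by simp

lemma exp_martingale_expectation:
  assumes "t \<in> {0..T}"
  shows "expectation (exp_martingale u t) = 1"
proof -
  have "0 < expectation (\<lambda>\<omega>. exp (u * X t \<omega>))"
    using X_lower[of u] assms by (auto intro: less_le_trans)
  then show ?thesis
    unfolding exp_martingale_eq[OF assms, abs_def] using X_exp[OF assms, of u] by simp
qed

text \<open>In terms of the increments along \<open>s\<close>, the sum inside \<open>g\<close> is
  increasing in each of them, since \<sigma> and all \<open>c j\<close> are nonnegative. The
  exponential weight at \<open>s k\<close> is the product of the weights of the increments up to
  \<open>k\<close>, so the reweighting inequality applies.\<close>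

lemma grid_test:
  fixes s :: "nat \<Rightarrow> real" and g :: "real \<Rightarrow> real" and c :: "nat \<Rightarrow> real"
  assumes \<sigma>: "0 \<le> \<sigma>" "\<sigma> \<le> \<tau>" and g: "mono g" "\<And>x. \<bar>g x\<bar> \<le> B" and c: "\<And>j. 0 \<le> c j"
    and s: "mono s" "\<And>j. s j \<in> {0..T}" and k: "k \<le> N"
  shows "0 \<le> expectation (\<lambda>\<omega>. g (\<Sum>j\<le>N. c j * exp (\<sigma> * X (s j) \<omega>)) * (exp_martingale \<tau> (s k) \<omega> - exp_martingale \<sigma> (s k) \<omega>))"
proof (cases "\<sigma> = \<tau>")
  case False
  define D where "D i \<omega> = (case i of 0 \<Rightarrow> X (s 0) \<omega> | Suc j \<Rightarrow> X (s (Suc j)) \<omega> - X (s j) \<omega>)" for i \<omega>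
  have sum_D: "(\<Sum>i\<le>j. D i \<omega>) = X (s j) \<omega>" for j \<omega>
    by (induction j) (simp_all add: D_def)
  have ind: "indep_vars (\<lambda>_. borel) D {..N}"
    unfolding D_def [abs_def] by (rule indep_vars_grid_increments[OF X_meas X_incr s])
  have D_meas [measurable]: "D i \<in> borel_measurable M" for i
    using X_meas[OF s(2)] by (cases i) (auto simp: D_def [abs_def] intro!: borel_measurable_diff)
  have D_exp: "integrable M (\<lambda>\<omega>. exp (u * D i \<omega>))" for u i
  proof (cases i)
    case 0
    then show ?thesis using X_exp[OF s(2)] by (simp add: D_def)
  next
    case (Suc j)
    show ?thesis
    proof (rule Bochner_Integration.integrable_bound)
      show "integrable M (\<lambda>\<omega>. exp ((2 * u) * X (s i) \<omega>) + exp ((- 2 * u) * X (s j) \<omega>))"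
        using X_exp[OF s(2)] by (intro Bochner_Integration.integrable_add)
      \<comment> \<open>\<open>u * (x - y)\<close> is the midpoint of \<open>2 * u * x\<close> and
        \<open>- 2 * u * y\<close>, so one of these is at least as large.\<close>
      have "exp (u * (x - y)) \<le> exp ((2 * u) * x) + exp ((- 2 * u) * y)" for x y :: real
      proof -
        have "exp (u * (x - y)) \<le> max (exp ((2 * u) * x)) (exp ((- 2 * u) * y))"
          unfolding le_max_iff_disj exp_le_cancel_iff by (simp add: algebra_simps) linarith
        also have "\<dots> \<le> exp ((2 * u) * x) + exp ((- 2 * u) * y)" by simp
        finally show ?thesis .
      qed
      then show "AE \<omega> in M. norm (exp (u * D i \<omega>)) \<le> norm (exp ((2 * u) * X (s i) \<omega>) + exp ((- 2 * u) * X (s j) \<omega>))"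
        by (intro AE_I2) (simp add: D_def Suc add_pos_pos abs_of_pos)
    qed measurable
  qed
  define A where "A u i = expectation (\<lambda>\<omega>. exp (u * D i \<omega>))" for u i
  have A_pos: "0 < A u i" for u i
    unfolding A_def using D_exp[of u i]
    by (subst integral_less_AE_space[of "\<lambda>_. 0", simplified]) (auto simp: emeasure_space_1)
  define w where "w u i x = exp (u * x) / A u i" for u i x
  have w_prod: "(\<Prod>i\<le>k. w u i (D i \<omega>)) = exp_martingale u (s k) \<omega>" for u \<omega>
  proof -
    have exp_prod: "(\<Prod>i\<le>k. exp (u * D i \<omega>)) = exp (u * X (s k) \<omega>)" for \<omega>
      by (simp add: exp_sum [symmetric] sum_distrib_left [symmetric] sum_D)
    \<comment> \<open>By independence the normalising constants of the increments multiply to that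
      of \<open>X (s k)\<close>.\<close>
    have "expectation (\<lambda>\<omega>. \<Prod>i\<le>k. exp (u * D i \<omega>)) = (\<Prod>i\<le>k. A u i)"
      unfolding A_def
    proof (rule indep_vars_lebesgue_integral)
      show "indep_vars (\<lambda>_. borel) (\<lambda>i \<omega>. exp (u * D i \<omega>)) {..k}"
        using k by (intro indep_vars_compose2[OF indep_vars_subset[OF ind]]) auto
    qed (use D_exp in auto)
    then show ?thesis
      by (simp add: w_def prod_dividef exp_prod exp_martingale_eq[OF s(2)])
  qed
  define F where "F d = g (\<Sum>j\<le>N. c j * exp (\<sigma> * (\<Sum>i\<le>j. d i)))" for d
  have [measurable]: "g \<in> borel_measurable borel" using g(1) by (rule borel_measurable_mono)
  have F_D: "F (\<lambda>i\<in>{..N}. D i \<omega>) = g (\<Sum>j\<le>N. c j * exp (\<sigma> * X (s j) \<omega>))" for \<omega>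
    unfolding F_def sum_D [symmetric] by (intro arg_cong[of _ _ g] sum.cong) auto
  have "expectation (\<lambda>\<omega>. F (\<lambda>i\<in>{..N}. D i \<omega>) * (\<Prod>i\<le>k. w \<sigma> i (D i \<omega>)))
      \<le> expectation (\<lambda>\<omega>. F (\<lambda>i\<in>{..N}. D i \<omega>) * (\<Prod>i\<le>k. w \<tau> i (D i \<omega>)))"
  \<comment> \<open>Both weights are exponentials and cross where the exponents agree:
    \<open>\<sigma> * x - ln (A \<sigma> i) = \<tau> * x - ln (A \<tau> i)\<close>.\<close>
  proof (rule indep_reweighting_mono[OF ind, where c = "\<lambda>i. ln (A \<tau> i / A \<sigma> i) / (\<tau> - \<sigma>)" and C = B])
    show "F \<in> borel_measurable (PiM {..N} (\<lambda>_. borel))"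
      unfolding F_def by measurable
    show "F d \<le> F e" if "\<And>i. i \<in> {..N} \<Longrightarrow> d i \<le> e i" for d e
      unfolding F_def using \<sigma> c that
      by (intro monoD[OF g(1)] sum_mono mult_left_mono) (auto intro!: mult_left_mono sum_mono)
    have w_le: "w \<sigma> i x \<le> w \<tau> i x \<longleftrightarrow> ln (A \<tau> i / A \<sigma> i) \<le> (\<tau> - \<sigma>) * x"
      "w \<tau> i x \<le> w \<sigma> i x \<longleftrightarrow> (\<tau> - \<sigma>) * x \<le> ln (A \<tau> i / A \<sigma> i)" for i x
    proof -
      have w_exp: "w u i x = exp (u * x - ln (A u i))" for u
        using A_pos[of u i] by (simp add: w_def exp_diff)
      show "w \<sigma> i x \<le> w \<tau> i x \<longleftrightarrow> ln (A \<tau> i / A \<sigma> i) \<le> (\<tau> - \<sigma>) * x"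
        "w \<tau> i x \<le> w \<sigma> i x \<longleftrightarrow> (\<tau> - \<sigma>) * x \<le> ln (A \<tau> i / A \<sigma> i)"
        using A_pos[of \<sigma> i] A_pos[of \<tau> i] unfolding w_exp by (auto simp: ln_div algebra_simps)
    qed
    show "w \<tau> i x \<le> w \<sigma> i x" if "x \<le> ln (A \<tau> i / A \<sigma> i) / (\<tau> - \<sigma>)" for i x
      using that \<sigma> False unfolding w_le by (simp add: field_simps)
    show "w \<sigma> i x \<le> w \<tau> i x" if "ln (A \<tau> i / A \<sigma> i) / (\<tau> - \<sigma>) \<le> x" for i x
      using that \<sigma> False unfolding w_le by (simp add: field_simps)
    have "expectation (\<lambda>\<omega>. w u i (D i \<omega>)) = 1" for u i
      using D_exp[of u i] A_pos[of u i] by (simp add: w_def A_def)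
    then show "expectation (\<lambda>\<omega>. w \<sigma> i (D i \<omega>)) = expectation (\<lambda>\<omega>. w \<tau> i (D i \<omega>))" for i
      by simp
    show "w u i \<in> borel_measurable borel" for u i unfolding w_def [abs_def] by measurable
  qed (use k g(2) D_exp A_pos in \<open>auto simp: F_def w_def less_imp_le\<close>)
  then have le: "expectation (\<lambda>\<omega>. F (\<lambda>i\<in>{..N}. D i \<omega>) * exp_martingale \<sigma> (s k) \<omega>)
      \<le> expectation (\<lambda>\<omega>. F (\<lambda>i\<in>{..N}. D i \<omega>) * exp_martingale \<tau> (s k) \<omega>)"
    unfolding w_prod .
  have [measurable]: "(\<lambda>\<omega>. F (\<lambda>i\<in>{..N}. D i \<omega>)) \<in> borel_measurable M"
    unfolding F_D using X_meas[OF s(2)] by measurable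
  have F_int: "integrable M (\<lambda>\<omega>. F (\<lambda>i\<in>{..N}. D i \<omega>) * exp_martingale u (s k) \<omega>)" for u
  proof (rule Bochner_Integration.integrable_bound[OF integrable_mult_right[of B, OF exp_martingale_integrable[OF s(2), of u]]])
    have [measurable]: "exp_martingale u (s k) \<in> borel_measurable M"
      using exp_martingale_integrable[OF s(2)] by auto
    show "(\<lambda>\<omega>. F (\<lambda>i\<in>{..N}. D i \<omega>) * exp_martingale u (s k) \<omega>) \<in> borel_measurable M"
      by measurable
    show "AE \<omega> in M. norm (F (\<lambda>i\<in>{..N}. D i \<omega>) * exp_martingale u (s k) \<omega>) \<le> norm (B * exp_martingale u (s k) \<omega>)"
      using order_trans[OF g(2) abs_ge_self] by (intro AE_I2) (auto simp: F_def abs_mult intro!: mult_right_mono)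
  qed
  from le show ?thesis
    unfolding F_D [symmetric] right_diff_distrib by (simp add: F_int Bochner_Integration.integral_diff[OF F_int F_int] del: restrict_apply)
qed simp


section \<open>Joint measurability, integrability and passage from grids to the average\<close>

sublocale mu: finite_measure \<mu> by (rule finite_mu)

sublocale mu_M: pair_sigma_finite \<mu> M ..

lemma space_mu: "space \<mu> = {0..T}"
  using sets_eq_imp_space_eq[OF sets_mu] by (simp add: space_restrict_space)

lemma measurable_borel_mu: "f \<in> measurable borel N \<Longrightarrow> f \<in> measurable \<mu> N"
  unfolding measurable_cong_sets[OF sets_mu refl] by (rule measurable_restrict_space1)

lemma X_grid_tendsto:
  assumes "\<omega> \<in> space M" and v: "v \<in> {0..T}" and t: "t \<in> {0..T}"
  shows "(\<lambda>n. X (grid T t (Suc n) (grid_index T t (Suc n) v)) \<omega>) \<longlonglongrightarrow> X v \<omega>"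
proof (rule cadlag_on_tendsto_from_right[OF X_cadlag[OF assms(1)] v])
  show "grid T t (Suc n) (grid_index T t (Suc n) v) \<in> {v..T}" for n
    using grid_grid_index[OF T v, of "Suc n" t] grid_in[OF T t] t by (auto simp del: of_nat_Suc)
qed (use grid_grid_index_tendsto[OF T v] t in auto)

text \<open>By right continuity \<open>X\<close> is the limit of processes that read the path only
  at grid points, and these are jointly measurable since the grid index takes countably many values.
  The point inserted into the grid is 0, an arbitrary choice.\<close>

lemma X_jointly_measurable: "(\<lambda>(t, \<omega>). X t \<omega>) \<in> borel_measurable (\<mu> \<Otimes>\<^sub>M M)"
proof (rule borel_measurable_LIMSEQ_real)
  fix x assume "x \<in> space (\<mu> \<Otimes>\<^sub>M M)"
  then show "(\<lambda>n. X (grid T 0 (Suc n) (grid_index T 0 (Suc n) (fst x))) (snd x)) \<longlonglongrightarrow> (\<lambda>(t, \<omega>). X t \<omega>) x"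
    using X_grid_tendsto[of "snd x" "fst x" 0] T by (auto simp: space_pair_measure space_mu)
next
  fix n
  show "(\<lambda>x. X (grid T 0 (Suc n) (grid_index T 0 (Suc n) (fst x))) (snd x)) \<in> borel_measurable (\<mu> \<Otimes>\<^sub>M M)"
  proof (rule measurable_compose_countable)
    show "(\<lambda>x. X (grid T 0 (Suc n) i) (snd x)) \<in> borel_measurable (\<mu> \<Otimes>\<^sub>M M)" for i
      by (rule measurable_compose[OF measurable_snd X_meas[OF grid_in[OF T]]]) (use T in simp)
    show "(\<lambda>x. grid_index T 0 (Suc n) (fst x)) \<in> measurable (\<mu> \<Otimes>\<^sub>M M) (count_space UNIV)"
      by (rule measurable_compose[OF measurable_fst measurable_borel_mu[OF measurable_grid_index]])
  qed
qed

lemma log_mgf_measurable: "(\<lambda>t. log_mgf M X u t) \<in> borel_measurable \<mu>"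
proof -
  have [measurable]: "(\<lambda>x. X (fst x) (snd x)) \<in> borel_measurable (\<mu> \<Otimes>\<^sub>M M)"
    using X_jointly_measurable by (simp add: case_prod_beta')
  have "(\<lambda>(t, \<omega>). exp (u * X t \<omega>)) \<in> borel_measurable (\<mu> \<Otimes>\<^sub>M M)"
    unfolding case_prod_beta' by measurable
  then show ?thesis
    unfolding log_mgf_def by (intro borel_measurable_ln borel_measurable_lebesgue_integral)
qed

lemma exp_martingale_jointly_measurable: "(\<lambda>(t, \<omega>). exp_martingale u t \<omega>) \<in> borel_measurable (\<mu> \<Otimes>\<^sub>M M)"
proof -
  have [measurable]: "(\<lambda>x. X (fst x) (snd x)) \<in> borel_measurable (\<mu> \<Otimes>\<^sub>M M)"
    using X_jointly_measurable by (simp add: case_prod_beta')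
  have [measurable]: "(\<lambda>x. log_mgf M X u (fst x)) \<in> borel_measurable (\<mu> \<Otimes>\<^sub>M M)"
    by (rule measurable_compose[OF measurable_fst log_mgf_measurable])
  show ?thesis
    unfolding exp_martingale_def case_prod_beta' by measurable
qed

text \<open>Tonelli's theorem: the weights are positive with mean 1 at every time, and \<mu> is
  finite.\<close>

lemma exp_martingale_product_integrable: "integrable (\<mu> \<Otimes>\<^sub>M M) (\<lambda>(t, \<omega>). exp_martingale u t \<omega>)"
proof (rule mu_M.Fubini_integrable[OF exp_martingale_jointly_measurable])
  have "(\<integral>\<omega>. norm (exp_martingale u t \<omega>) \<partial>M) = 1" if "t \<in> space \<mu>" for t
  proof -
    have "norm (exp_martingale u t \<omega>) = exp_martingale u t \<omega>" for \<omega> by (simp add: exp_martingale_def)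
    then show ?thesis using exp_martingale_expectation[of t u] that by (simp add: space_mu)
  qed
  then show "integrable \<mu> (\<lambda>t. \<integral>\<omega>. norm (case (t, \<omega>) of (t, \<omega>) \<Rightarrow> exp_martingale u t \<omega>) \<partial>M)"
    by (subst Bochner_Integration.integrable_cong[OF refl, of _ _ "\<lambda>_. 1"]) auto
  show "AE t in \<mu>. integrable M (\<lambda>\<omega>. case (t, \<omega>) of (t, \<omega>) \<Rightarrow> exp_martingale u t \<omega>)"
    using exp_martingale_integrable by (intro AE_I2) (simp add: space_mu)
qed

lemma average_integrable: "integrable M (\<lambda>\<omega>. \<integral>t. exp_martingale u t \<omega> \<partial>\<mu>)"
  by (rule mu_M.integrable_snd[OF exp_martingale_product_integrable])

text \<open>Only \<open>X\<close> is moved to the grid point; the normalisation stays at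
  \<open>v\<close>, so right continuity of the path alone gives the pointwise limit.\<close>

lemma average_grid_tendsto:
  assumes \<omega>: "\<omega> \<in> space M" and t: "t \<in> {0..T}"
  shows "(\<lambda>n. \<integral>v. exp (u * X (grid T t (Suc n) (grid_index T t (Suc n) v)) \<omega> - log_mgf M X u v) \<partial>\<mu>)
    \<longlonglongrightarrow> (\<integral>v. exp_martingale u v \<omega> \<partial>\<mu>)"
proof -
  obtain B where B: "\<And>v. v \<in> {0..T} \<Longrightarrow> \<bar>X v \<omega>\<bar> \<le> B"
    using cadlag_on_bounded[OF X_cadlag[OF \<omega>]] by blast
  obtain c where c: "0 < c" "\<And>v. v \<in> {0..T} \<Longrightarrow> c \<le> expectation (\<lambda>\<omega>. exp (u * X v \<omega>))"
    using X_lower[of u] by auto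
  \<comment> \<open>\<open>B\<close> depends on the path, but \<omega> is fixed here: dominated
    convergence is over \<mu>, for which constants are integrable.\<close>
  have bound: "\<bar>exp (u * X r \<omega> - log_mgf M X u v)\<bar> \<le> exp (\<bar>u\<bar> * B - ln c)"
    if "r \<in> {0..T}" "v \<in> {0..T}" for r v
  proof -
    have "u * X r \<omega> \<le> \<bar>u\<bar> * B"
      using B[OF that(1)] by (metis abs_ge_self abs_ge_zero abs_mult mult_left_mono order_trans)
    moreover have "ln c \<le> log_mgf M X u v"
      unfolding log_mgf_def using c(1) c(2)[OF that(2)] by simp
    ultimately show ?thesis by simp
  qed
  have index_meas: "grid_index T t n \<in> measurable \<mu> (count_space UNIV)" for n
    by (rule measurable_borel_mu[OF measurable_grid_index])
  have [measurable]: "(\<lambda>v. X v \<omega>) \<in> borel_measurable \<mu>"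
    using measurable_compose[OF measurable_Pair2'[OF \<omega>] X_jointly_measurable] by simp
  have [measurable]: "(\<lambda>v. X (grid T t n (grid_index T t n v)) \<omega>) \<in> borel_measurable \<mu>" for n
    by (rule measurable_compose_countable[OF _ index_meas]) simp
  note log_mgf_measurable [measurable]
  show ?thesis
  proof (rule integral_dominated_convergence[where w = "\<lambda>_. exp (\<bar>u\<bar> * B - ln c)"])
    show "AE v in \<mu>. (\<lambda>n. exp (u * X (grid T t (Suc n) (grid_index T t (Suc n) v)) \<omega> - log_mgf M X u v))
        \<longlonglongrightarrow> exp_martingale u v \<omega>"
      unfolding exp_martingale_def using X_grid_tendsto[OF \<omega> _ t]
      by (intro AE_I2 tendsto_intros) (simp add: space_mu)
    show "AE v in \<mu>. norm (exp (u * X (grid T t (Suc n) (grid_index T t (Suc n) v)) \<omega> - log_mgf M X u v))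
        \<le> exp (\<bar>u\<bar> * B - ln c)" for n
      using bound[OF grid_in[OF T t]] by (intro AE_I2) (simp add: space_mu)
  qed (simp_all add: exp_martingale_def)
qed

text \<open>Grouping \<open>v\<close> by grid index turns the integral into a finite sum with
  deterministic nonnegative coefficients, the form that \<open>grid_test\<close> takes.\<close>

lemma average_grid_eq_sum:
  assumes \<omega>: "\<omega> \<in> space M" and t: "t \<in> {0..T}" and n: "0 < n"
  shows "(\<integral>v. exp (u * X (grid T t n (grid_index T t n v)) \<omega> - log_mgf M X u v) \<partial>\<mu>)
    = (\<Sum>j\<le>2 * n. (\<integral>v. indicator {v. grid_index T t n v = j} v * exp (- log_mgf M X u v) \<partial>\<mu>)
        * exp (u * X (grid T t n j) \<omega>))"
proof -
  let ?h = "\<lambda>j v. indicator {v. grid_index T t n v = j} v * exp (- log_mgf M X u v) :: real"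
  obtain c where c: "0 < c" "\<And>v. v \<in> {0..T} \<Longrightarrow> c \<le> expectation (\<lambda>\<omega>. exp (u * X v \<omega>))"
    using X_lower[of u] by auto
  note log_mgf_measurable [measurable]
  have h_int: "integrable \<mu> (?h j)" for j
  proof (rule mu.integrable_const_bound[where B = "exp (- ln c)"])
    have "{v. grid_index T t n v = j} \<in> sets borel"
      using measurable_sets[OF measurable_grid_index, of "{j}" T t n] by (simp add: vimage_def)
    then have [measurable]: "(indicator {v. grid_index T t n v = j} :: real \<Rightarrow> real) \<in> borel_measurable \<mu>"
      by (intro measurable_borel_mu) simp
    show "?h j \<in> borel_measurable \<mu>" by measurable
    have "ln c \<le> log_mgf M X u v" if "v \<in> {0..T}" for v
      unfolding log_mgf_def using c(1) c(2)[OF that] by simp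
    then show "AE v in \<mu>. norm (?h j v) \<le> exp (- ln c)"
      by (intro AE_I2) (auto simp: space_mu indicator_def)
  qed
  have "(\<integral>v. exp (u * X (grid T t n (grid_index T t n v)) \<omega> - log_mgf M X u v) \<partial>\<mu>)
      = (\<integral>v. (\<Sum>j\<le>2 * n. ?h j v * exp (u * X (grid T t n j) \<omega>)) \<partial>\<mu>)"
  proof (rule Bochner_Integration.integral_cong[OF refl])
    fix v assume "v \<in> space \<mu>"
    then have le: "grid_index T t n v \<le> 2 * n"
      using grid_index_le[OF T _ n] t by (simp add: space_mu)
    have "(\<Sum>j\<le>2 * n. ?h j v * exp (u * X (grid T t n j) \<omega>))
        = (\<Sum>j\<in>{grid_index T t n v}. ?h j v * exp (u * X (grid T t n j) \<omega>))"
      using le by (intro sum.mono_neutral_right) auto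
    then show "exp (u * X (grid T t n (grid_index T t n v)) \<omega> - log_mgf M X u v)
        = (\<Sum>j\<le>2 * n. ?h j v * exp (u * X (grid T t n j) \<omega>))"
      by (simp add: exp_diff exp_minus field_simps)
  qed
  also have "\<dots> = (\<Sum>j\<le>2 * n. (\<integral>v. ?h j v \<partial>\<mu>) * exp (u * X (grid T t n j) \<omega>))"
    using h_int by simp
  finally show ?thesis .
qed

text \<open>The grid contains \<open>t\<close> at index \<open>Suc n\<close>, so the weights at
  \<open>t\<close> are kept exactly and only the average inside \<open>g\<close> is approximated.
  Continuity of \<open>g\<close> gives convergence, and its boundedness gives domination.\<close>

lemma pointwise_test:
  assumes \<sigma>: "0 \<le> \<sigma>" "\<sigma> \<le> \<tau>" and g: "continuous_on UNIV g" "mono g" "\<And>x. \<bar>g x\<bar> \<le> B"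
    and t: "t \<in> {0..T}"
  shows "0 \<le> expectation (\<lambda>\<omega>. g (\<integral>v. exp_martingale \<sigma> v \<omega> \<partial>\<mu>) * (exp_martingale \<tau> t \<omega> - exp_martingale \<sigma> t \<omega>))"
proof (rule LIMSEQ_le_const)
  have [measurable]: "g \<in> borel_measurable borel" using g(2) by (rule borel_measurable_mono)
  have [measurable]: "(\<lambda>\<omega>. \<integral>v. exp_martingale \<sigma> v \<omega> \<partial>\<mu>) \<in> borel_measurable M"
    using average_integrable by blast
  have [measurable]: "exp_martingale u t \<in> borel_measurable M" for u
    using exp_martingale_integrable[OF t] by blast
  define a where "a n \<omega> = (\<integral>v. exp (\<sigma> * X (grid T t (Suc n) (grid_index T t (Suc n) v)) \<omega> - log_mgf M X \<sigma> v) \<partial>\<mu>)" for n \<omega>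
  define c where "c n j = (\<integral>v. indicator {v. grid_index T t (Suc n) v = j} v * exp (- log_mgf M X \<sigma> v) \<partial>\<mu>)" for n j
  have a_eq: "a n \<omega> = (\<Sum>j\<le>2 * Suc n. c n j * exp (\<sigma> * X (grid T t (Suc n) j) \<omega>))" if "\<omega> \<in> space M" for n \<omega>
    unfolding a_def c_def by (rule average_grid_eq_sum[OF that t]) simp
  have a_meas [measurable]: "a n \<in> borel_measurable M" for n
  proof (subst measurable_cong[OF a_eq])
    show "(\<lambda>\<omega>. \<Sum>j\<le>2 * Suc n. c n j * exp (\<sigma> * X (grid T t (Suc n) j) \<omega>)) \<in> borel_measurable M"
      using X_meas[OF grid_in[OF T t]] by measurable
  qed
  have bound_int: "integrable M (\<lambda>\<omega>. B * \<bar>exp_martingale \<tau> t \<omega> - exp_martingale \<sigma> t \<omega>\<bar>)"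
    using exp_martingale_integrable[OF t] by (intro integrable_mult_right integrable_abs Bochner_Integration.integrable_diff)
  show "(\<lambda>n. expectation (\<lambda>\<omega>. g (a n \<omega>) * (exp_martingale \<tau> t \<omega> - exp_martingale \<sigma> t \<omega>)))
    \<longlonglongrightarrow> expectation (\<lambda>\<omega>. g (\<integral>v. exp_martingale \<sigma> v \<omega> \<partial>\<mu>) * (exp_martingale \<tau> t \<omega> - exp_martingale \<sigma> t \<omega>))"
  proof (rule integral_dominated_convergence[OF _ _ bound_int])
    show "AE \<omega> in M. (\<lambda>n. g (a n \<omega>) * (exp_martingale \<tau> t \<omega> - exp_martingale \<sigma> t \<omega>))
        \<longlonglongrightarrow> g (\<integral>v. exp_martingale \<sigma> v \<omega> \<partial>\<mu>) * (exp_martingale \<tau> t \<omega> - exp_martingale \<sigma> t \<omega>)"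
      unfolding a_def
      by (intro AE_I2 tendsto_mult tendsto_const continuous_on_tendsto_compose[OF g(1)] average_grid_tendsto t) auto
    show "AE \<omega> in M. norm (g (a n \<omega>) * (exp_martingale \<tau> t \<omega> - exp_martingale \<sigma> t \<omega>)) \<le> B * \<bar>exp_martingale \<tau> t \<omega> - exp_martingale \<sigma> t \<omega>\<bar>" for n
      using g(3) by (intro AE_I2) (simp add: abs_mult mult_right_mono)
  qed measurable
  have "0 \<le> expectation (\<lambda>\<omega>. g (a n \<omega>) * (exp_martingale \<tau> t \<omega> - exp_martingale \<sigma> t \<omega>))" for n
  proof -
    have "0 \<le> expectation (\<lambda>\<omega>. g (\<Sum>j\<le>2 * Suc n. c n j * exp (\<sigma> * X (grid T t (Suc n) j) \<omega>))
        * (exp_martingale \<tau> (grid T t (Suc n) (Suc n)) \<omega> - exp_martingale \<sigma> (grid T t (Suc n) (Suc n)) \<omega>))"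
      by (rule grid_test[OF \<sigma> g(2,3) _ mono_grid[OF T t] grid_in[OF T t]]) (auto simp: c_def)
    also have "\<dots> = expectation (\<lambda>\<omega>. g (a n \<omega>) * (exp_martingale \<tau> t \<omega> - exp_martingale \<sigma> t \<omega>))"
      using grid_self[OF T t, of "Suc n"] by (intro Bochner_Integration.integral_cong) (simp_all add: a_eq del: sum.atMost_Suc)
    finally show ?thesis .
  qed
  then show "\<exists>N. \<forall>n\<ge>N. 0 \<le> expectation (\<lambda>\<omega>. g (a n \<omega>) * (exp_martingale \<tau> t \<omega> - exp_martingale \<sigma> t \<omega>))" by blast
qed

text \<open>\<open>pointwise_test\<close> is integrated over \<open>t\<close>: the factor with
  \<open>g\<close> does not depend on \<open>t\<close>, so Fubini's theorem moves the integral onto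
  the difference of the weights.\<close>

lemma average_test:
  assumes \<sigma>: "0 \<le> \<sigma>" "\<sigma> \<le> \<tau>" and g: "continuous_on UNIV g" "mono g" "\<And>x. \<bar>g x\<bar> \<le> B"
  shows "0 \<le> expectation (\<lambda>\<omega>. g (\<integral>v. exp_martingale \<sigma> v \<omega> \<partial>\<mu>) * ((\<integral>v. exp_martingale \<tau> v \<omega> \<partial>\<mu>) - (\<integral>v. exp_martingale \<sigma> v \<omega> \<partial>\<mu>)))"
proof -
  define G where "G \<omega> = g (\<integral>v. exp_martingale \<sigma> v \<omega> \<partial>\<mu>)" for \<omega>
  have [measurable]: "g \<in> borel_measurable borel" using g(2) by (rule borel_measurable_mono)
  have [measurable]: "(\<lambda>\<omega>. \<integral>v. exp_martingale \<sigma> v \<omega> \<partial>\<mu>) \<in> borel_measurable M"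
    using average_integrable by blast
  have [measurable]: "G \<in> borel_measurable M" unfolding G_def [abs_def] by measurable
  have [measurable]: "(\<lambda>x. exp_martingale u (fst x) (snd x)) \<in> borel_measurable (\<mu> \<Otimes>\<^sub>M M)" for u
    using exp_martingale_jointly_measurable by (simp add: case_prod_beta')
  have prod_int: "integrable (\<mu> \<Otimes>\<^sub>M M) (\<lambda>x. exp_martingale u (fst x) (snd x))" for u
    using exp_martingale_product_integrable by (simp add: case_prod_beta')
  have int: "integrable (\<mu> \<Otimes>\<^sub>M M) (\<lambda>(t, \<omega>). G \<omega> * (exp_martingale \<tau> t \<omega> - exp_martingale \<sigma> t \<omega>))"
  proof (rule Bochner_Integration.integrable_bound)
    show "integrable (\<mu> \<Otimes>\<^sub>M M) (\<lambda>x. B * \<bar>exp_martingale \<tau> (fst x) (snd x) - exp_martingale \<sigma> (fst x) (snd x)\<bar>)"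
      using prod_int by (intro integrable_mult_right integrable_abs Bochner_Integration.integrable_diff)
    show "(\<lambda>(t, \<omega>). G \<omega> * (exp_martingale \<tau> t \<omega> - exp_martingale \<sigma> t \<omega>)) \<in> borel_measurable (\<mu> \<Otimes>\<^sub>M M)"
      unfolding case_prod_beta' by measurable
    show "AE x in \<mu> \<Otimes>\<^sub>M M. norm (case x of (t, \<omega>) \<Rightarrow> G \<omega> * (exp_martingale \<tau> t \<omega> - exp_martingale \<sigma> t \<omega>))
        \<le> norm (B * \<bar>exp_martingale \<tau> (fst x) (snd x) - exp_martingale \<sigma> (fst x) (snd x)\<bar>)"
      using order_trans[OF g(3) abs_ge_self]
      by (intro AE_I2) (auto simp: case_prod_beta' abs_mult G_def intro!: mult_right_mono)
  qed
  have "0 \<le> (\<integral>t. expectation (\<lambda>\<omega>. G \<omega> * (exp_martingale \<tau> t \<omega> - exp_martingale \<sigma> t \<omega>)) \<partial>\<mu>)"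
    unfolding G_def by (rule Bochner_Integration.integral_nonneg) (simp only: space_mu pointwise_test[OF \<sigma> g])
  also have "\<dots> = expectation (\<lambda>\<omega>. \<integral>t. G \<omega> * (exp_martingale \<tau> t \<omega> - exp_martingale \<sigma> t \<omega>) \<partial>\<mu>)"
    by (rule mu_M.Fubini_integral [symmetric, OF int])
  also have "\<dots> = expectation (\<lambda>\<omega>. G \<omega> * ((\<integral>v. exp_martingale \<tau> v \<omega> \<partial>\<mu>) - (\<integral>v. exp_martingale \<sigma> v \<omega> \<partial>\<mu>)))"
  proof (rule integral_cong_AE)
    \<comment> \<open>Splitting the inner integral of the difference needs both sections integrable
      over \<mu>, which Fubini's theorem grants for almost every \<omega>.\<close>
    have AE: "AE \<omega> in M. integrable \<mu> (\<lambda>t. exp_martingale u t \<omega>)" for u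
      by (rule mu_M.AE_integrable_snd[OF exp_martingale_product_integrable])
    show "AE \<omega> in M. (\<integral>t. G \<omega> * (exp_martingale \<tau> t \<omega> - exp_martingale \<sigma> t \<omega>) \<partial>\<mu>)
        = G \<omega> * ((\<integral>v. exp_martingale \<tau> v \<omega> \<partial>\<mu>) - (\<integral>v. exp_martingale \<sigma> v \<omega> \<partial>\<mu>))"
      using AE[of \<sigma>] AE[of \<tau>] by eventually_elim simp
    show "(\<lambda>\<omega>. \<integral>t. G \<omega> * (exp_martingale \<tau> t \<omega> - exp_martingale \<sigma> t \<omega>) \<partial>\<mu>) \<in> borel_measurable M"
      using mu_M.integrable_snd[OF int] by blast
    show "(\<lambda>\<omega>. G \<omega> * ((\<integral>v. exp_martingale \<tau> v \<omega> \<partial>\<mu>) - (\<integral>v. exp_martingale \<sigma> v \<omega> \<partial>\<mu>))) \<in> borel_measurable M"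
      using borel_measurable_integrable[OF average_integrable[of \<tau>]] by measurable
  qed
  finally show ?thesis by (simp add: G_def)
qed

end

section \<open>The peacock property\<close>

theorem corollary6p1:
  fixes M :: "'a measure" and T :: real and \<mu> :: "real measure"
    and X :: "real \<Rightarrow> 'a \<Rightarrow> real"
  assumes "prob_space M"
    and "T > 0"
    and "finite_measure \<mu>"
    and "sets \<mu> = sets (restrict_space borel {0..T})"
    and "\<And>t. t \<in> {0..T} \<Longrightarrow> X t \<in> borel_measurable M"
    and "\<And>\<omega>. \<omega> \<in> space M \<Longrightarrow> cadlag_on 0 T (\<lambda>t. X t \<omega>)"
    and "independent_increments M T X"
    and "\<And>u t. t \<in> {0..T} \<Longrightarrow> integrable M (\<lambda>\<omega>. exp (u * X t \<omega>))"
    and "\<And>u. bounded ((\<lambda>t. \<integral>\<omega>. exp (u * X t \<omega>) \<partial>M) ` {0..T})"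
    and "\<And>u. \<exists>c>0. \<forall>t\<in>{0..T}. c \<le> (\<integral>\<omega>. exp (u * X t \<omega>) \<partial>M)"
  shows "peacock M (\<lambda>\<sigma> \<omega>. \<integral>t. exp (\<sigma> * X t \<omega> - log_mgf M X \<sigma> t) \<partial>\<mu>)"
proof -
  interpret indep_exp_process M T \<mu> X
    using assms by (intro indep_exp_process.intro indep_exp_process_axioms.intro)
  show ?thesis
    unfolding peacock_def exp_martingale_def [symmetric]
  proof (intro conjI allI impI mono_onI)
    show "integrable M (\<lambda>\<omega>. \<integral>t. exp_martingale l t \<omega> \<partial>\<mu>)" for l
      by (rule average_integrable)
    show "ext_expectation M (\<lambda>\<omega>. \<phi> (\<integral>t. exp_martingale r t \<omega> \<partial>\<mu>))
        \<le> ext_expectation M (\<lambda>\<omega>. \<phi> (\<integral>t. exp_martingale s t \<omega> \<partial>\<mu>))"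
      if "convex_on UNIV \<phi>" "r \<in> {0..}" "r \<le> s" for \<phi> r s
      using that by (intro ext_expectation_convex_mono average_integrable average_test) auto
  qed
qed

end
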